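(* Let $A\in\mathbb{R}^{n\times n}$ be a Metzler matrix, let $B\in\mathbb{R}^{n\times m}$, $C\in\mathbb{R}^{m\times n}$, $D\in\mathbb{R}^{m\times m}$ be entrywise nonnegative, let $D$ be a Schur matrix, and assume $s(A+B(I-D)^{-1}C)<0$. Let $h_M>0$, and let $\overline{\psi}\in\mathbb{R}^n$, $\overline{\phi}\in\mathbb{R}^m$ be nonnegative vectors. Then there exist positive vectors $p\in\mathbb{R}^n$, $q\in\mathbb{R}^m$ (all entries $>0$), a scalar $\mu\in(0,1)$ and a time $T^*\ge h_M$ such that the following holds. For all continuous delays $h_1,h_2:[0,\infty)\to[0,h_M]$, all initial data $\psi\in\mathbb{R}^n$ with $0\preceq\psi\preceq\overline{\psi}$ and $\phi:[-h_M,0)\to\mathbb{R}^m$ with $0\preceq\phi(s)\preceq\overline{\phi}$ for all $s\in[-h_M,0)$, every solution $(x,y)$ of $$\dot x(t)=Ax(t)+By(t-h_1(t)),\qquad y(t)=Cx(t)+Dy(t-h_2(t)),\qquad t\ge 0,$$ with $x(0)=\psi$ and $y(s)=\phi(s)$ for $s\in[-h_M,0)$ satisfies, for every $k=0,1,2,\dots$, $$x(t)\preceq(1-\mu)^k p\quad\text{and}\quad y(t)\preceq(1-\mu)^{k+1}q\qquad\text{for all } t\in[kT^*,(k+1)T^* ).$$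
   Context: Vector inequalities are componentwise: $x\preceq y$ means $x_i\le y_i$ for all $i$. A real square matrix is Metzler if all its off-diagonal entries are nonnegative, and Schur if its spectral radius is $<1$. $s(M)=\max\{\mathrm{Re}\,\lambda:\lambda\in\sigma(M)\}$ is the spectral abscissa. A solution is a pair $(x,y)$ with $x:[0,\infty)\to\mathbb{R}^n$ locally absolutely continuous and $y:[-h_M,\infty)\to\mathbb{R}^m$ locally bounded, satisfying the differential equation for almost every $t\ge 0$, the difference equation for every $t\ge 0$, and the initial conditions. *)

theory Defs
  imports "HOL-Analysis.Analysis"
begin

(* The order of "HOL-Analysis" on vectors and matrices is componentwise, so "0 \<le> M" for a matrix
   M means entrywise nonnegativity.  Strict componentwise inequality is not "<" on vectors and is
   always written out with indices. *)

definition metzler :: "real^'n^'n \<Rightarrow> bool" where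
  "metzler M \<longleftrightarrow> (\<forall>i j. i \<noteq> j \<longrightarrow> 0 \<le> M $ i $ j)"

(* Complex eigenvalues of a real matrix.  This set is finite and nonempty, so the two uses of Max
   below are genuine maxima. *)
definition spectrum :: "real^'n^'n \<Rightarrow> complex set" where
  "spectrum M = {z. \<exists>v :: complex^'n. v \<noteq> 0 \<and> map_matrix complex_of_real M *v v = z *s v}"

definition spectral_radius :: "real^'n^'n \<Rightarrow> real" where
  "spectral_radius M = Max (cmod ` spectrum M)"

definition spectral_abscissa :: "real^'n^'n \<Rightarrow> real" where
  "spectral_abscissa M = Max (Re ` spectrum M)"

definition schur :: "real^'n^'n \<Rightarrow> bool" where
  "schur M \<longleftrightarrow> spectral_radius M < 1"

(* Epsilon-delta definition; a finite family of non-overlapping compact intervals is represented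
   as a division of its union, and K = {Inf K..Sup K}. *)
definition abs_continuous_on :: "real \<Rightarrow> real \<Rightarrow> (real \<Rightarrow> 'a::real_normed_vector) \<Rightarrow> bool" where
  "abs_continuous_on a b f \<longleftrightarrow>
     (\<forall>\<epsilon>>0. \<exists>\<delta>>0. \<forall>\<D>. \<D> division_of \<Union>\<D> \<and> \<Union>\<D> \<subseteq> {a..b} \<and> (\<Sum>K\<in>\<D>. Sup K - Inf K) < \<delta>
        \<longrightarrow> (\<Sum>K\<in>\<D>. norm (f (Sup K) - f (Inf K))) < \<epsilon>)"

definition locally_abs_continuous_on :: "real set \<Rightarrow> (real \<Rightarrow> 'a::real_normed_vector) \<Rightarrow> bool" where
  "locally_abs_continuous_on S f \<longleftrightarrow> (\<forall>a b. {a..b} \<subseteq> S \<longrightarrow> abs_continuous_on a b f)"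

definition locally_bounded_on :: "real set \<Rightarrow> (real \<Rightarrow> 'a::real_normed_vector) \<Rightarrow> bool" where
  "locally_bounded_on S f \<longleftrightarrow> (\<forall>a b. {a..b} \<subseteq> S \<longrightarrow> bounded (f ` {a..b}))"

definition delay :: "real \<Rightarrow> (real \<Rightarrow> real) \<Rightarrow> bool" where
  "delay hM h \<longleftrightarrow> continuous_on {0..} h \<and> h ` {0..} \<subseteq> {0..hM}"

(* Functions are total: x is relevant only on {0..}, y on {- hM..}, \<phi> on {- hM..<0} and the
   delays on {0..}. *)
definition is_solution ::
  "real^'n^'n \<Rightarrow> real^'m^'n \<Rightarrow> real^'n^'m \<Rightarrow> real^'m^'m \<Rightarrow> real \<Rightarrow> (real \<Rightarrow> real) \<Rightarrow> (real \<Rightarrow> real)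
    \<Rightarrow> real^'n \<Rightarrow> (real \<Rightarrow> real^'m) \<Rightarrow> (real \<Rightarrow> real^'n) \<Rightarrow> (real \<Rightarrow> real^'m) \<Rightarrow> bool" where
  "is_solution A B C D hM h\<^sub>1 h\<^sub>2 \<psi> \<phi> x y \<longleftrightarrow>
     locally_abs_continuous_on {0..} x \<and>
     locally_bounded_on {- hM..} y \<and>
     (AE t in lebesgue. 0 \<le> t \<longrightarrow>
        (x has_vector_derivative (A *v x t + B *v y (t - h\<^sub>1 t))) (at t within {0..})) \<and>
     (\<forall>t\<ge>0. y t = C *v x t + D *v y (t - h\<^sub>2 t)) \<and>
     x 0 = \<psi> \<and>
     (\<forall>s\<in>{- hM..<0}. y s = \<phi> s)"

end

(* A Metzler matrix M without real eigenvalue >= 0 admits p > 0 with M p < 0.  Applied to D - I and to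
   A + B (I - D)^{-1} C this yields p, q > 0 with A p + B q <= - delta p and C p + D q <= (1 - mu) q.
   If x and y are bounded by (r + K) p and (r + K) q on [a, b], with bound r p, r q for the data at time a,
   then substituting into the equations improves K to theta K for some theta < 1 depending only on b - a;
   iterating gives the bounds r p and r q.  This argument needs neither continuity of y nor a positive
   lower bound on the delays.  With these bounds each deviation z = r p_i - x_i satisfies
   z' >= - alpha z + r delta p_i, so after a fixed time T it exceeds r mu p_i, and the argument restarts
   with (1 - mu) r. *)

theory Submission
  imports Defs "HOL-Computational_Algebra.Polynomial"
begin

subsection \<open>Spectrum and Metzler matrices\<close>

text \<open>This is why a bound is improved on a whole interval at once, starting from a finite
  bound that may depend on the solution. The two components gain differently. The difference
  equation passes a bound on to \<open>y\<close> with the factor 1 - \<mu> at once, whereas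
  \<open>x\<close> has to wait until its deviation is close enough to the equilibrium of a scalar
  linear equation; hence the extra power of 1 - \<mu> for \<open>y\<close>. The rate \<mu> is at
  most half of the relative equilibrium \<delta> / \<alpha>, and half of it is reached after time ln
  2 / \<alpha>. \<open>T\<close> is also at least \<open>hM\<close>, so that the history seen at the
  start of a period lies in the preceding period. Since \<open>x\<close> is differentiable only
  almost everywhere, the comparison with the scalar equation rests on absolute continuity.\<close>

lemma poly_det:
  fixes P :: "'a::comm_ring_1 poly^'n^'n"
  shows "poly (det P) z = det (\<chi> i j. poly (P $ i $ j) z)"
  by (simp add: det_def poly_sum poly_prod)

lemma mat_mult_vec: "mat l *v v = l *s (v :: 'a::comm_semiring_1^'n)"
proof -
  have "mat l $ i $ j * v $ j = (if j = i then l * v $ j else 0)" for i j :: 'n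
    by (simp add: mat_def)
  then show ?thesis
    by (simp add: matrix_vector_mult_def vec_eq_iff)
qed

lemma mem_spectrum_iff_det:
  "z \<in> spectrum M \<longleftrightarrow> det (mat z - map_matrix complex_of_real M) = 0"
proof -
  have "(mat z - map_matrix complex_of_real M) *v v = z *s v - map_matrix complex_of_real M *v v" for v
    by (simp add: matrix_vector_mult_diff_rdistrib mat_mult_vec)
  then have "(mat z - map_matrix complex_of_real M) *v v = 0 \<longleftrightarrow>
      map_matrix complex_of_real M *v v = z *s v" for v
    by (simp only: right_minus_eq) (rule eq_commute)
  then have "z \<in> spectrum M \<longleftrightarrow>
      \<not> (\<forall>v. (mat z - map_matrix complex_of_real M) *v v = 0 \<longrightarrow> v = 0)"
    unfolding spectrum_def mem_Collect_eq by blast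
  then show ?thesis
    by (simp flip: matrix_left_invertible_ker invertible_left_inverse add: invertible_det_nz)
qed

text \<open>Evaluate the eigenvalue equation in a row where the eigenvector has an entry of largest
  modulus. The bound is crude, but it supplies a number outside the spectrum, so that the
  characteristic polynomial is not zero.\<close>

lemma spectrum_bounded:
  assumes "z \<in> spectrum M"
  shows "cmod z \<le> (\<Sum>i\<in>UNIV. \<Sum>j\<in>UNIV. \<bar>M $ i $ j\<bar>)"
proof -
  obtain v where v: "v \<noteq> 0" and eq: "map_matrix complex_of_real M *v v = z *s v"
    using assms by (auto simp: spectrum_def)
  have "Max (range (\<lambda>j. cmod (v $ j))) \<in> range (\<lambda>j. cmod (v $ j))"
    by (intro Max_in) auto
  then obtain k where "Max (range (\<lambda>j. cmod (v $ j))) = cmod (v $ k)"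
    unfolding image_iff by blast
  then have k: "cmod (v $ j) \<le> cmod (v $ k)" for j
    by (metis Max_ge finite finite_imageI rangeI)
  have "v $ k \<noteq> 0"
    using v k by (metis norm_le_zero_iff norm_zero vec_eq_iff zero_index)
  have "cmod z * cmod (v $ k) = cmod (\<Sum>j\<in>UNIV. of_real (M $ k $ j) * v $ j)"
    using arg_cong[OF eq, of "\<lambda>w. cmod (w $ k)"] by (simp add: matrix_vector_mult_def norm_mult)
  also have "\<dots> \<le> (\<Sum>j\<in>UNIV. \<bar>M $ k $ j\<bar> * cmod (v $ k))"
    by (intro sum_norm_le) (simp add: norm_mult k mult_left_mono)
  also have "\<dots> = (\<Sum>j\<in>UNIV. \<bar>M $ k $ j\<bar>) * cmod (v $ k)"
    by (simp add: sum_distrib_right)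
  finally have "cmod z \<le> (\<Sum>j\<in>UNIV. \<bar>M $ k $ j\<bar>)"
    using \<open>v $ k \<noteq> 0\<close> by simp
  also have "\<dots> \<le> (\<Sum>i\<in>UNIV. \<Sum>j\<in>UNIV. \<bar>M $ i $ j\<bar>)"
    by (intro member_le_sum sum_nonneg) auto
  finally show ?thesis .
qed

text \<open>Makes \<open>Max_ge\<close> applicable, which is how a single real eigenvalue is
  compared with \<open>spectral_radius\<close> and \<open>spectral_abscissa\<close>.\<close>

lemma finite_spectrum: "finite (spectrum M)"
proof -
  \<comment> \<open>\<open>P\<close> is z I - M with z as the polynomial variable, so
    \<open>det P\<close> is the characteristic polynomial.\<close>
  define P :: "complex poly^'a^'a"
    where "P = (\<chi> i j. [:- of_real (M $ i $ j), if i = j then 1 else 0:])"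
  have "(\<chi> i j. poly (P $ i $ j) z) = mat z - map_matrix complex_of_real M" for z
    by (simp add: P_def mat_def vec_eq_iff)
  then have eq: "spectrum M = {z. poly (det P) z = 0}"
    by (auto simp: mem_spectrum_iff_det poly_det)
  define r where "r = (\<Sum>i\<in>UNIV. \<Sum>j\<in>UNIV. \<bar>M $ i $ j\<bar>) + 1"
  have "cmod (of_real r) = r"
    unfolding norm_of_real r_def by (intro abs_of_nonneg add_nonneg_nonneg sum_nonneg) auto
  then have "of_real r \<notin> spectrum M"
    using spectrum_bounded[of "of_real r" M] unfolding r_def by linarith
  then have "det P \<noteq> 0"
    unfolding eq by auto
  then show ?thesis
    unfolding eq by (rule poly_roots_finite)
qed

lemma real_eigenvalue_in_spectrum:
  assumes "M *v v = l *s v" "v \<noteq> 0"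
  shows "of_real l \<in> spectrum M"
proof -
  have "map_matrix complex_of_real M *v (\<chi> i. of_real (v $ i)) = of_real l *s (\<chi> i. of_real (v $ i))"
    using assms(1) by (simp add: matrix_vector_mult_def vec_eq_iff flip: of_real_mult of_real_sum)
  moreover have "(\<chi> i. complex_of_real (v $ i)) \<noteq> 0"
    using assms(2) by (simp add: vec_eq_iff)
  ultimately show ?thesis
    unfolding spectrum_def by blast
qed

section \<open>Metzler matrices: maximum principle and positive strict subsolutions\<close>

lemma matrix_vector_mult_mono:
  fixes B :: "real^'n^'m"
  assumes "0 \<le> B" "u \<le> v"
  shows "B *v u \<le> B *v v"
  using assms by (auto simp: less_eq_vec_def matrix_vector_mult_def intro!: sum_mono mult_left_mono)

text \<open>Only the diagonal entry can contribute negatively. In particular (M w)_i >= 0 wherever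
  w_i = 0, which drives the maximum principle; along solutions the diagonal term gives the decay
  rate \<alpha>.\<close>

lemma metzler_mult_component_ge:
  assumes "metzler M" "0 \<le> w"
  shows "M $ i $ i * w $ i \<le> (M *v w) $ i"
proof -
  have "(M *v w) $ i = M $ i $ i * w $ i + (\<Sum>j\<in>UNIV - {i}. M $ i $ j * w $ j)"
    unfolding matrix_vector_mult_def by (simp add: sum.remove)
  moreover have "0 \<le> (\<Sum>j\<in>UNIV - {i}. M $ i $ j * w $ j)"
    using assms by (intro sum_nonneg mult_nonneg_nonneg) (auto simp: metzler_def less_eq_vec_def)
  ultimately show ?thesis by simp
qed

text \<open>Take the smallest \<open>c\<close> with v + c p >= 0. The sum vanishes in some component
  \<open>k\<close>, so (M (v + c p))_k >= 0, while for positive \<open>c\<close> the hypotheses make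
  this number negative. Hence c <= 0 and v >= - c p >= 0.\<close>

lemma metzler_inverse_nonneg:
  fixes M :: "real^'n^'n"
  assumes M: "metzler M" and p: "\<And>i. 0 < p $ i" "\<And>i. (M *v p) $ i < 0" and v: "M *v v \<le> 0"
  shows "0 \<le> v"
proof -
  define c where "c = Max (range (\<lambda>i. - (v $ i) / p $ i))"
  have "c \<in> range (\<lambda>i. - (v $ i) / p $ i)"
    unfolding c_def by (intro Max_in) auto
  then obtain k where k: "c = - (v $ k) / p $ k"
    by auto
  have "- (v $ i) / p $ i \<le> c" for i
    unfolding c_def by (intro Max_ge) auto
  then have ge: "0 \<le> v $ i + c * p $ i" for i
    using p(1)[of i] by (metis diff_ge_0_iff_ge pos_divide_le_eq diff_minus_eq_add add.commute)
  have "c \<le> 0"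
  proof (rule ccontr)
    assume "\<not> c \<le> 0"
    then have "c * (M *v p) $ k < 0"
      using p(2) by (simp add: mult_pos_neg)
    moreover have "(M *v v) $ k \<le> 0"
      using v by (simp add: less_eq_vec_def)
    moreover have "M $ k $ k * (v + c *s p) $ k \<le> (M *v (v + c *s p)) $ k"
      using M ge by (intro metzler_mult_component_ge) (auto simp: less_eq_vec_def)
    moreover have "(v + c *s p) $ k = 0"
      using p(1)[of k] by (simp add: k)
    ultimately show False
      by (simp add: matrix_vector_right_distrib vector_scalar_commute)
  qed
  then have "c * p $ i \<le> 0" for i
    using p(1)[of i] by (simp add: mult_nonpos_nonneg)
  then show ?thesis
    using ge by (auto simp: less_eq_vec_def) (smt (verit))
qed

lemma metzler_shift:
  assumes "metzler M"
  shows "metzler (M - mat l)"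
  using assms by (auto simp: metzler_def mat_def)

lemma shift_mult_vec:
  fixes M :: "real^'n^'n"
  shows "(M - mat l) *v v = M *v v - l *s v"
  by (simp add: matrix_vector_mult_diff_rdistrib mat_mult_vec)

(* Continuation in l: the set S of l >= 0 for which M - l I admits such a vector is open and closed in
   {0..}, because (l I - M)^{-1} exists for all l >= 0 and is nonnegative for l in S. *)
lemma metzler_strict_subsolution:
  fixes M :: "real^'n^'n"
  assumes M: "metzler M" and ev: "\<And>l v. 0 \<le> l \<Longrightarrow> M *v v = l *s v \<Longrightarrow> v = 0"
  shows "\<exists>p. (\<forall>i. 0 < p $ i) \<and> (\<forall>i. (M *v p) $ i < 0)"
proof -
  define S where "S = {l. 0 \<le> l \<and> (\<exists>p. (\<forall>i. 0 < p $ i) \<and> (\<forall>i. (M *v p) $ i < l * p $ i))}"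
  define e :: "real^'n" where "e = (\<chi> i. 1)"
  have inv: "\<exists>N. N ** (M - mat l) = mat 1 \<and> (M - mat l) ** N = mat 1" if "0 \<le> l" for l
    using ev[OF that] matrix_left_invertible_ker[of "M - mat l"]
    by (auto simp: shift_mult_vec matrix_left_right_inverse)
  \<comment> \<open>The witnesses in \<open>S\<close> for different \<open>l\<close> are unrelated.
    Solutions for the fixed right-hand side \<open>- e\<close> can be compared, and they stay
    nonnegative in the limit as \<open>l\<close> decreases to the infimum \<open>l0\<close>.\<close>
  have sol: "\<exists>u. 0 \<le> u \<and> (M - mat l) *v u = - e" if l: "l \<in> S" for l
  proof -
    obtain p where p: "\<And>i. 0 < p $ i" "\<And>i. (M *v p) $ i < l * p $ i" and "0 \<le> l"
      using l by (auto simp: S_def)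
    obtain N where "(M - mat l) ** N = mat 1"
      using inv[OF \<open>0 \<le> l\<close>] by auto
    then have "(M - mat l) *v (N *v (- e)) = - e"
      by (simp add: matrix_vector_mul_assoc)
    moreover from this have "0 \<le> N *v (- e)"
      using p by (intro metzler_inverse_nonneg[OF metzler_shift[OF M], of p l])
        (auto simp: shift_mult_vec less_eq_vec_def e_def)
    ultimately show ?thesis by blast
  qed
  define l0 where "l0 = Inf S"
  have bdd: "bdd_below S"
    by (auto simp: S_def intro: bdd_belowI[of _ 0])
  \<comment> \<open>For large \<open>l\<close> the vector \<open>e\<close> itself is a witness, so
    \<open>S\<close> is not empty.\<close>
  define L where "L = (\<Sum>i\<in>UNIV. \<bar>(M *v e) $ i\<bar>) + 1"
  have "\<bar>(M *v e) $ i\<bar> < L" for i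
    using member_le_sum[of i UNIV "\<lambda>i. \<bar>(M *v e) $ i\<bar>"] by (simp add: L_def)
  then have "(M *v e) $ i < L" for i
    by (simp add: abs_less_iff)
  moreover have "0 \<le> L"
    unfolding L_def by (intro add_nonneg_nonneg sum_nonneg) auto
  ultimately have "L \<in> S"
    by (auto simp: S_def e_def intro!: exI[of _ e])
  then have "S \<noteq> {}" by auto
  then have "0 \<le> l0"
    unfolding l0_def by (intro cInf_greatest) (auto simp: S_def)
  then obtain N where N: "N ** (M - mat l0) = mat 1" "(M - mat l0) ** N = mat 1"
    using inv by blast
  define p0 where "p0 = N *v (- e)"
  have "(M - mat l0) *v p0 = - e"
    using N(2) by (simp add: p0_def matrix_vector_mul_assoc)
  then have p0: "M *v p0 = l0 *s p0 - e"
    by (simp add: shift_mult_vec mat_mult_vec vec_eq_iff algebra_simps)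
  obtain K where "0 < K" and K: "\<And>x. norm (N *v x) \<le> K * norm x"
    using linear_bounded_pos[OF matrix_vector_mul_linear[of N]] by (metis mult.commute)
  have "0 \<le> p0 $ i" for i
  proof (rule ccontr)
    assume neg: "\<not> 0 \<le> p0 $ i"
    \<comment> \<open>The bound 1/2 yields norm u <= 2 norm p0; the other bound then brings
      \<open>u\<close> closer to \<open>p0\<close> than - p0_i, which is impossible for u_i >=
      0.\<close>
    define \<eta> where "\<eta> = min (1/2) (- (p0 $ i) / (4 * norm p0)) / K"
    have "0 < norm p0"
      using neg by auto
    then have "0 < \<eta>"
      using neg \<open>0 < K\<close> unfolding \<eta>_def by (simp add: divide_neg_pos)
    then obtain l where "l \<in> S" and l: "l < l0 + \<eta>"
      using cInf_lessD[OF \<open>S \<noteq> {}\<close>, of "l0 + \<eta>"] by (auto simp: l0_def)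
    have "l0 \<le> l"
      unfolding l0_def using bdd \<open>l \<in> S\<close> by (intro cInf_lower)
    obtain u where "0 \<le> u" and u: "(M - mat l) *v u = - e"
      using sol[OF \<open>l \<in> S\<close>] by blast
    have "u - p0 = N *v ((M - mat l0) *v u - (- e))"
      unfolding p0_def matrix_vector_mult_diff_distrib matrix_vector_mul_assoc N(1) by simp
    also have "(M - mat l0) *v u - (- e) = (l - l0) *s u"
      using u unfolding shift_mult_vec vec_eq_iff by (simp add: algebra_simps)
    finally have "norm (u - p0) \<le> K * ((l - l0) * norm u)"
      using K[of "(l - l0) *s u"] \<open>l0 \<le> l\<close> by (simp add: scalar_mult_eq_scaleR del: vector_scaleR_component)
    also have "\<dots> \<le> K * (\<eta> * norm u)"
      using l \<open>0 < K\<close> by (intro mult_left_mono mult_right_mono) auto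
    finally have d: "norm (u - p0) \<le> (K * \<eta>) * norm u" by simp
    have "(K * \<eta>) * norm u \<le> 1/2 * norm u"
      using \<open>0 < K\<close> by (intro mult_right_mono) (auto simp: \<eta>_def)
    then have "norm u \<le> 2 * norm p0"
      using d norm_triangle_sub[of u p0] by linarith
    have "(K * \<eta>) * norm u \<le> (- (p0 $ i) / (4 * norm p0)) * (2 * norm p0)"
      using \<open>norm u \<le> 2 * norm p0\<close> \<open>0 < K\<close> neg
      by (intro mult_mono) (auto simp: \<eta>_def intro!: divide_nonpos_nonneg)
    also have "\<dots> = - (p0 $ i) / 2"
      using \<open>0 < norm p0\<close> by simp
    finally have "norm (u - p0) < - (p0 $ i)"
      using d neg by linarith
    moreover have "\<bar>u $ i - p0 $ i\<bar> \<le> norm (u - p0)"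
      using component_le_norm_cart[of "u - p0" i] by simp
    moreover have "0 \<le> u $ i"
      using \<open>0 \<le> u\<close> by (simp add: less_eq_vec_def)
    ultimately show False by linarith
  qed
  then have "0 \<le> p0"
    by (simp add: less_eq_vec_def)
  \<comment> \<open>If p0_i were 0, then (M p0)_i would be nonnegative, yet the equation for
    \<open>p0\<close> gives the value -1.\<close>
  have pos: "0 < p0 $ i" for i
  proof (rule ccontr)
    assume "\<not> 0 < p0 $ i"
    then have "p0 $ i = 0"
      using \<open>0 \<le> p0\<close> by (auto simp: less_eq_vec_def intro: antisym)
    then show False
      using metzler_mult_component_ge[OF M \<open>0 \<le> p0\<close>, of i] p0 by (simp add: e_def)
  qed
  have sub: "(M *v p0) $ i < l0 * p0 $ i" for i
    by (simp add: p0 e_def)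
  have "l0 = 0"
  proof (rule ccontr)
    assume "l0 \<noteq> 0"
    \<comment> \<open>The least l >= 0 with M p0 <= l p0. It lies below a positive
      \<open>l0\<close>, so the midpoint would be an element of \<open>S\<close> below its
      infimum.\<close>
    define l where "l = Max (insert 0 (range (\<lambda>i. (M *v p0) $ i / p0 $ i)))"
    have "l < l0"
      using \<open>0 \<le> l0\<close> \<open>l0 \<noteq> 0\<close> sub pos by (auto simp: l_def pos_divide_less_eq)
    have "(M *v p0) $ i / p0 $ i \<le> l" for i
      unfolding l_def by (intro Max_ge) auto
    then have "(M *v p0) $ i \<le> l * p0 $ i" for i
      using pos by (simp add: pos_divide_le_eq)
    moreover have "l * p0 $ i < (l + l0) / 2 * p0 $ i" for i
      using pos[of i] \<open>l < l0\<close> by (intro mult_strict_right_mono) auto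
    ultimately have "(M *v p0) $ i < (l + l0) / 2 * p0 $ i" for i
      by (rule order_le_less_trans)
    moreover have "0 \<le> l"
      unfolding l_def by (intro Max_ge) auto
    ultimately have "(l + l0) / 2 \<in> S"
      using pos \<open>0 \<le> l0\<close> unfolding S_def by (intro CollectI conjI exI[of _ p0] allI) auto
    then have "l0 \<le> (l + l0) / 2"
      using bdd unfolding l0_def by (intro cInf_lower)
    then show False
      using \<open>l < l0\<close> by simp
  qed
  then show ?thesis
    using pos sub by auto
qed

lemma spectral_abscissa_neg_imp_strict_subsolution:
  fixes M :: "real^'n^'n"
  assumes "metzler M" "spectral_abscissa M < 0"
  shows "\<exists>p. (\<forall>i. 0 < p $ i) \<and> (\<forall>i. (M *v p) $ i < 0)"
proof (rule metzler_strict_subsolution[OF assms(1)])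
  fix l :: real and v assume "0 \<le> l" and v: "M *v v = l *s v"
  show "v = 0"
  proof (rule ccontr)
    assume "v \<noteq> 0"
    then have "l \<in> Re ` spectrum M"
      using real_eigenvalue_in_spectrum[OF v] by (metis Re_complex_of_real image_eqI)
    then have "l \<le> spectral_abscissa M"
      unfolding spectral_abscissa_def by (intro Max_ge) (auto simp: finite_spectrum)
    with \<open>0 \<le> l\<close> assms(2) show False by simp
  qed
qed

text \<open>An eigenvalue l >= 0 of D - I is an eigenvalue l + 1 >= 1 of D, which a spectral radius
  below 1 excludes.\<close>

lemma schur_imp_strict_subsolution:
  fixes D :: "real^'n^'n"
  assumes "0 \<le> D" "schur D"
  shows "\<exists>r. (\<forall>i. 0 < r $ i) \<and> (\<forall>i. (D *v r) $ i < r $ i)"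
proof -
  have "metzler D"
    using assms(1) by (auto simp: metzler_def less_eq_vec_def)
  then have "\<exists>p. (\<forall>i. 0 < p $ i) \<and> (\<forall>i. ((D - mat 1) *v p) $ i < 0)"
  proof (rule metzler_strict_subsolution[OF metzler_shift])
    fix l :: real and v assume "0 \<le> l" and "(D - mat 1) *v v = l *s v"
    then have v: "D *v v = (l + 1) *s v"
      by (simp add: shift_mult_vec vec_eq_iff algebra_simps)
    show "v = 0"
    proof (rule ccontr)
      assume "v \<noteq> 0"
      then have "cmod (of_real (l + 1)) \<in> cmod ` spectrum D"
        using real_eigenvalue_in_spectrum[OF v] by blast
      then have "cmod (of_real (l + 1)) \<le> spectral_radius D"
        unfolding spectral_radius_def by (intro Max_ge) (auto simp: finite_spectrum)
      with \<open>0 \<le> l\<close> assms(2) show False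
        unfolding norm_of_real schur_def by simp
    qed
  qed
  then show ?thesis
    by (simp add: shift_mult_vec)
qed

text \<open>With q = (I - D)^{-1} C p the second relation is an equality and A p + B q is the
  negative vector M p, where M = A + B (I - D)^{-1} C. Adding \<epsilon> r with D r < r makes the
  second relation strict and \<open>q\<close> positive; a small \<epsilon> keeps the first one
  strict.\<close>

lemma strict_supersolution_exists:
  fixes A :: "real^'n^'n" and B :: "real^'m^'n" and C :: "real^'n^'m" and D :: "real^'m^'m"
  assumes "metzler A" "0 \<le> B" "0 \<le> C" "0 \<le> D" "schur D"
    and "spectral_abscissa (A + B ** matrix_inv (mat 1 - D) ** C) < 0"
  shows "\<exists>p q. (\<forall>i. 0 < p $ i) \<and> (\<forall>j. 0 < q $ j) \<and>
    (\<forall>i. (A *v p + B *v q) $ i < 0) \<and> (\<forall>j. (C *v p + D *v q) $ j < q $ j)"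
proof -
  obtain r where r: "\<And>i. 0 < r $ i" "\<And>i. (D *v r) $ i < r $ i"
    using schur_imp_strict_subsolution[OF \<open>0 \<le> D\<close> \<open>schur D\<close>] by blast
  have "metzler (D - mat 1)"
    using \<open>0 \<le> D\<close> by (intro metzler_shift) (auto simp: metzler_def less_eq_vec_def)
  \<comment> \<open>Positivity of the inverse of I - D, stated before the inverse is known to exist:
    applied to v and to -v it yields injectivity.\<close>
  then have nonneg: "0 \<le> v" if "D *v v \<le> v" for v
    by (rule metzler_inverse_nonneg[where p = r]) (use r that in \<open>auto simp: shift_mult_vec\<close>)
  have "v = 0" if "D *v v = v" for v
  proof -
    have "D *v (- v) = - v"
      using that by (simp add: matrix_vector_mult_def sum_negf vec_eq_iff)
    then show ?thesis
      using nonneg[of v] nonneg[of "- v"] that by simp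
  qed
  then have "invertible (mat 1 - D)"
    by (auto simp: invertible_left_inverse matrix_left_invertible_ker matrix_vector_mult_diff_rdistrib)
  define I where "I = matrix_inv (mat 1 - D)"
  have "(mat 1 - D) ** I = mat 1"
    using \<open>invertible (mat 1 - D)\<close> unfolding I_def matrix_inv_def invertible_def by (metis (mono_tags, lifting) someI_ex)
  then have I: "I *v v - D *v (I *v v) = v" for v
    by (metis matrix_vector_mul_assoc matrix_vector_mul_lid matrix_vector_mult_diff_rdistrib)
  have I_nonneg: "0 \<le> I *v v" if "0 \<le> v" for v
    by (rule nonneg) (use I[of v] that in \<open>metis diff_ge_0_iff_ge\<close>)
  let ?M = "A + B ** I ** C"
  have M: "?M *v v = A *v v + B *v (I *v (C *v v))" for v
    by (simp add: matrix_vector_mult_add_rdistrib matrix_vector_mul_assoc matrix_mul_assoc)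
  have mono0: "0 \<le> G *v v" if "0 \<le> G" "0 \<le> v" for G :: "real^'a^'b" and v
    using matrix_vector_mult_mono[OF that] by simp
  have "metzler ?M"
    unfolding metzler_def
  proof (intro allI impI)
    fix i j :: 'n assume "i \<noteq> j"
    \<comment> \<open>Testing with a unit vector shows that each off-diagonal entry of
      \<open>?M\<close> is at least the one of \<open>A\<close>.\<close>
    have "0 \<le> (axis j 1 :: real^'n)"
      by (auto simp: less_eq_vec_def axis_def)
    then have "0 \<le> B *v (I *v (C *v axis j 1))"
      by (intro mono0 I_nonneg assms)
    then have "(A *v axis j 1) $ i \<le> (?M *v axis j 1) $ i"
      unfolding M by (simp add: less_eq_vec_def)
    then show "0 \<le> ?M $ i $ j"
      using \<open>metzler A\<close> \<open>i \<noteq> j\<close> unfolding matrix_vector_mult_basis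
      by (auto simp: column_def metzler_def intro: order_trans)
  qed
  then obtain p where p: "\<And>i. 0 < p $ i" "\<And>i. (?M *v p) $ i < 0"
    using spectral_abscissa_neg_imp_strict_subsolution assms(6) unfolding I_def by blast
  have "0 \<le> C *v p"
    using p(1) by (intro mono0 assms) (auto simp: less_eq_vec_def less_imp_le)
  have q0: "0 \<le> I *v (C *v p)"
    by (intro I_nonneg \<open>0 \<le> C *v p\<close>)
  \<comment> \<open>1 / \<epsilon> exceeds every ratio of (B r)_i to - (?M p)_i, so \<epsilon> B r
    cannot use up the negativity of \<open>?M *v p\<close>.\<close>
  define m where "m = Max (range (\<lambda>i. (B *v r) $ i / - (?M *v p) $ i))"
  define \<epsilon> where "\<epsilon> = 1 / (1 + max 0 m)"
  have "0 < \<epsilon>"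
    by (simp add: \<epsilon>_def add_pos_nonneg)
  have "(?M *v p) $ i + \<epsilon> * (B *v r) $ i < 0" for i
  proof -
    have "(B *v r) $ i / - (?M *v p) $ i \<le> m"
      unfolding m_def by (intro Max_ge) auto
    also have "m < 1 + max 0 m" by simp
    also have "\<dots> = 1 / \<epsilon>" by (simp add: \<epsilon>_def)
    finally have "(B *v r) $ i < 1 / \<epsilon> * - (?M *v p) $ i"
      using p(2)[of i] by (subst (asm) pos_divide_less_eq) auto
    then have "\<epsilon> * (B *v r) $ i < \<epsilon> * (1 / \<epsilon> * - (?M *v p) $ i)"
      using \<open>0 < \<epsilon>\<close> by (intro mult_strict_left_mono)
    then show ?thesis
      using \<open>0 < \<epsilon>\<close> by simp
  qed
  moreover define q where "q = I *v (C *v p) + \<epsilon> *s r"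
  ultimately have "(A *v p + B *v q) $ i < 0" for i
    by (simp add: M matrix_vector_right_distrib vector_scalar_commute add.assoc)
  moreover have "(C *v p + D *v q) $ j < q $ j" for j
  proof -
    have "q $ j - (D *v q) $ j = (C *v p) $ j + \<epsilon> * (r $ j - (D *v r) $ j)"
      using arg_cong[OF I[of "C *v p"], of "\<lambda>v. v $ j"]
      by (simp add: q_def matrix_vector_right_distrib vector_scalar_commute algebra_simps)
    moreover have "0 < \<epsilon> * (r $ j - (D *v r) $ j)"
      using \<open>0 < \<epsilon>\<close> r(2)[of j] by simp
    ultimately show ?thesis by simp
  qed
  moreover have "0 < q $ j" for j
    using q0 \<open>0 < \<epsilon>\<close> r(1)[of j] by (simp add: q_def less_eq_vec_def add_nonneg_pos)
  ultimately show ?thesis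
    using p(1) by blast
qed

subsection \<open>Absolutely continuous functions\<close>

lemma abs_continuous_onE:
  assumes "abs_continuous_on a b f" "0 < \<epsilon>"
  obtains \<delta> where "0 < \<delta>"
    "\<And>\<D>. \<D> division_of \<Union>\<D> \<Longrightarrow> \<Union>\<D> \<subseteq> {a..b} \<Longrightarrow> (\<Sum>K\<in>\<D>. Sup K - Inf K) < \<delta> \<Longrightarrow>
      (\<Sum>K\<in>\<D>. norm (f (Sup K) - f (Inf K))) < \<epsilon>"
  using assms unfolding abs_continuous_on_def by meson

lemma division_real_interval:
  fixes K :: "real set"
  assumes "\<D> division_of S" "K \<in> \<D>"
  shows "K = {Inf K..Sup K}" "Inf K \<le> Sup K" "Inf K \<in> S" "Sup K \<in> S"
proof -
  obtain u v where "K = cbox u v" "K \<noteq> {}"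
    using division_ofD(3,4)[OF assms] by blast
  then show "K = {Inf K..Sup K}" "Inf K \<le> Sup K"
    by auto
  then have "Inf K \<in> K" "Sup K \<in> K"
    by (metis atLeastAtMost_iff order_refl)+
  then show "Inf K \<in> S" "Sup K \<in> S"
    using division_ofD(2)[OF assms] by blast+
qed

lemma abs_continuous_on_imp_continuous_on:
  assumes f: "abs_continuous_on a b f"
  shows "continuous_on {a..b} f"
  unfolding continuous_on_iff
proof (intro ballI allI impI)
  fix t \<epsilon> :: real assume t: "t \<in> {a..b}" and "0 < \<epsilon>"
  obtain \<delta> where "0 < \<delta>" and \<delta>: "\<And>\<D>. \<D> division_of \<Union>\<D> \<Longrightarrow> \<Union>\<D> \<subseteq> {a..b} \<Longrightarrow>
      (\<Sum>K\<in>\<D>. Sup K - Inf K) < \<delta> \<Longrightarrow> (\<Sum>K\<in>\<D>. norm (f (Sup K) - f (Inf K))) < \<epsilon>"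
    using abs_continuous_onE[OF f \<open>0 < \<epsilon>\<close>] by blast
  have *: "norm (f v - f u) < \<epsilon>" if "a \<le> u" "u \<le> v" "v \<le> b" "v - u < \<delta>" for u v
    using \<delta>[of "{cbox u v}"] that division_of_self[of u v] by auto
  show "\<exists>d>0. \<forall>s\<in>{a..b}. dist s t < d \<longrightarrow> dist (f s) (f t) < \<epsilon>"
  proof (intro exI[of _ \<delta>] conjI ballI impI)
    fix s assume "s \<in> {a..b}" "dist s t < \<delta>"
    then show "dist (f s) (f t) < \<epsilon>"
      using *[of s t] *[of t s] t by (cases "s \<le> t") (auto simp: dist_norm norm_minus_commute)
  qed (fact \<open>0 < \<delta>\<close>)
qed

text \<open>Passes absolute continuity from \<open>x\<close> to the scalar deviations c p_i - x_i
  and to shifts by a constant.\<close>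

lemma abs_continuous_on_norm_le:
  assumes f: "abs_continuous_on a b f"
    and le: "\<And>u v. u \<in> {a..b} \<Longrightarrow> v \<in> {a..b} \<Longrightarrow> norm (g v - g u) \<le> norm (f v - f u)"
  shows "abs_continuous_on a b g"
  unfolding abs_continuous_on_def
proof (intro allI impI)
  fix \<epsilon> :: real assume "0 < \<epsilon>"
  obtain \<delta> where "0 < \<delta>" and \<delta>: "\<And>\<D>. \<D> division_of \<Union>\<D> \<Longrightarrow> \<Union>\<D> \<subseteq> {a..b} \<Longrightarrow>
      (\<Sum>K\<in>\<D>. Sup K - Inf K) < \<delta> \<Longrightarrow> (\<Sum>K\<in>\<D>. norm (f (Sup K) - f (Inf K))) < \<epsilon>"
    using abs_continuous_onE[OF f \<open>0 < \<epsilon>\<close>] by blast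
  show "\<exists>\<delta>>0. \<forall>\<D>. \<D> division_of \<Union>\<D> \<and> \<Union>\<D> \<subseteq> {a..b} \<and> (\<Sum>K\<in>\<D>. Sup K - Inf K) < \<delta> \<longrightarrow>
      (\<Sum>K\<in>\<D>. norm (g (Sup K) - g (Inf K))) < \<epsilon>"
  proof (intro exI[of _ \<delta>] conjI allI impI; (elim conjE)?)
    fix \<D> assume \<D>: "\<D> division_of \<Union>\<D>" "\<Union>\<D> \<subseteq> {a..b}" "(\<Sum>K\<in>\<D>. Sup K - Inf K) < \<delta>"
    have "(\<Sum>K\<in>\<D>. norm (g (Sup K) - g (Inf K))) \<le> (\<Sum>K\<in>\<D>. norm (f (Sup K) - f (Inf K)))"
      by (intro sum_mono le subsetD[OF \<D>(2)] division_real_interval[OF \<D>(1)])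
    also have "\<dots> < \<epsilon>"
      using \<delta> \<D> by blast
    finally show "(\<Sum>K\<in>\<D>. norm (g (Sup K) - g (Inf K))) < \<epsilon>" .
  qed (fact \<open>0 < \<delta>\<close>)
qed

lemma lipschitz_on_imp_abs_continuous_on:
  fixes f :: "real \<Rightarrow> 'a::real_normed_vector"
  assumes f: "L-lipschitz_on {a..b} f"
  shows "abs_continuous_on a b f"
  unfolding abs_continuous_on_def
proof (intro allI impI)
  fix \<epsilon> :: real assume "0 < \<epsilon>"
  have "0 \<le> L"
    using f by (rule lipschitz_on_nonneg)
  show "\<exists>\<delta>>0. \<forall>\<D>. \<D> division_of \<Union>\<D> \<and> \<Union>\<D> \<subseteq> {a..b} \<and> (\<Sum>K\<in>\<D>. Sup K - Inf K) < \<delta> \<longrightarrow>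
      (\<Sum>K\<in>\<D>. norm (f (Sup K) - f (Inf K))) < \<epsilon>"
  proof (intro exI[of _ "\<epsilon> / (L + 1)"] conjI allI impI; (elim conjE)?)
    fix \<D> assume \<D>: "\<D> division_of \<Union>\<D>" "\<Union>\<D> \<subseteq> {a..b}" "(\<Sum>K\<in>\<D>. Sup K - Inf K) < \<epsilon> / (L + 1)"
    have nn: "0 \<le> (\<Sum>K\<in>\<D>. Sup K - Inf K)"
      using division_real_interval(2)[OF \<D>(1)] by (intro sum_nonneg) simp
    have "norm (f (Sup K) - f (Inf K)) \<le> L * (Sup K - Inf K)" if "K \<in> \<D>" for K
      using lipschitz_onD[OF f, of "Sup K" "Inf K"] division_real_interval(2-)[OF \<D>(1) that] \<D>(2)
      by (simp add: dist_norm subset_iff)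
    then have "(\<Sum>K\<in>\<D>. norm (f (Sup K) - f (Inf K))) \<le> (\<Sum>K\<in>\<D>. L * (Sup K - Inf K))"
      by (intro sum_mono)
    also have "\<dots> \<le> (L + 1) * (\<Sum>K\<in>\<D>. Sup K - Inf K)"
      using nn unfolding sum_distrib_left[symmetric] by (intro mult_right_mono) auto
    also have "\<dots> < \<epsilon>"
      using \<D>(3) \<open>0 \<le> L\<close> by (simp add: field_simps)
    finally show "(\<Sum>K\<in>\<D>. norm (f (Sup K) - f (Inf K))) < \<epsilon>" .
  qed (use \<open>0 < \<epsilon>\<close> \<open>0 \<le> L\<close> in auto)
qed

lemma abs_continuous_on_mult:
  fixes f g :: "real \<Rightarrow> real"
  assumes f: "abs_continuous_on a b f" and g: "abs_continuous_on a b g"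
  shows "abs_continuous_on a b (\<lambda>t. f t * g t)"
  unfolding abs_continuous_on_def
proof (intro allI impI)
  fix \<epsilon> :: real assume "0 < \<epsilon>"
  have bnd: "\<exists>G>0. \<forall>t\<in>{a..b}. \<bar>g t\<bar> \<le> G" if "abs_continuous_on a b g" for g :: "real \<Rightarrow> real"
  proof -
    have "bounded (g ` {a..b})"
      using that by (intro compact_imp_bounded compact_continuous_image
          abs_continuous_on_imp_continuous_on) auto
    then show ?thesis
      by (simp add: bounded_pos)
  qed
  obtain F where "0 < F" and F: "\<And>t. t \<in> {a..b} \<Longrightarrow> \<bar>f t\<bar> \<le> F"
    using bnd[OF f] by blast
  obtain G where "0 < G" and G: "\<And>t. t \<in> {a..b} \<Longrightarrow> \<bar>g t\<bar> \<le> G"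
    using bnd[OF g] by blast
  have "0 < \<epsilon> / (2 * F)" "0 < \<epsilon> / (2 * G)"
    using \<open>0 < \<epsilon>\<close> \<open>0 < F\<close> \<open>0 < G\<close> by auto
  obtain \<delta>\<^sub>f where "0 < \<delta>\<^sub>f" and \<delta>\<^sub>f: "\<And>\<D>. \<D> division_of \<Union>\<D> \<Longrightarrow> \<Union>\<D> \<subseteq> {a..b} \<Longrightarrow>
      (\<Sum>K\<in>\<D>. Sup K - Inf K) < \<delta>\<^sub>f \<Longrightarrow> (\<Sum>K\<in>\<D>. norm (f (Sup K) - f (Inf K))) < \<epsilon> / (2 * G)"
    using abs_continuous_onE[OF f \<open>0 < \<epsilon> / (2 * G)\<close>] by blast
  obtain \<delta>\<^sub>g where "0 < \<delta>\<^sub>g" and \<delta>\<^sub>g: "\<And>\<D>. \<D> division_of \<Union>\<D> \<Longrightarrow> \<Union>\<D> \<subseteq> {a..b} \<Longrightarrow>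
      (\<Sum>K\<in>\<D>. Sup K - Inf K) < \<delta>\<^sub>g \<Longrightarrow> (\<Sum>K\<in>\<D>. norm (g (Sup K) - g (Inf K))) < \<epsilon> / (2 * F)"
    using abs_continuous_onE[OF g \<open>0 < \<epsilon> / (2 * F)\<close>] by blast
  show "\<exists>\<delta>>0. \<forall>\<D>. \<D> division_of \<Union>\<D> \<and> \<Union>\<D> \<subseteq> {a..b} \<and> (\<Sum>K\<in>\<D>. Sup K - Inf K) < \<delta> \<longrightarrow>
      (\<Sum>K\<in>\<D>. norm (f (Sup K) * g (Sup K) - f (Inf K) * g (Inf K))) < \<epsilon>"
  proof (intro exI[of _ "min \<delta>\<^sub>f \<delta>\<^sub>g"] conjI allI impI; (elim conjE)?)
    fix \<D> assume \<D>: "\<D> division_of \<Union>\<D>" "\<Union>\<D> \<subseteq> {a..b}" "(\<Sum>K\<in>\<D>. Sup K - Inf K) < min \<delta>\<^sub>f \<delta>\<^sub>g"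
    have "norm (f v * g v - f u * g u) \<le> F * norm (g v - g u) + G * norm (f v - f u)"
      if "u \<in> {a..b}" "v \<in> {a..b}" for u v
    proof -
      have "f v * g v - f u * g u = f v * (g v - g u) + g u * (f v - f u)"
        by (simp add: algebra_simps)
      then have "norm (f v * g v - f u * g u) \<le> \<bar>f v\<bar> * norm (g v - g u) + \<bar>g u\<bar> * norm (f v - f u)"
        by (metis abs_mult norm_triangle_ineq real_norm_def)
      also have "\<dots> \<le> F * norm (g v - g u) + G * norm (f v - f u)"
        using F G that by (intro add_mono mult_right_mono) auto
      finally show ?thesis .
    qed
    then have "(\<Sum>K\<in>\<D>. norm (f (Sup K) * g (Sup K) - f (Inf K) * g (Inf K))) \<le>
        (\<Sum>K\<in>\<D>. F * norm (g (Sup K) - g (Inf K)) + G * norm (f (Sup K) - f (Inf K)))"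
      by (intro sum_mono) (use subsetD[OF \<D>(2)] division_real_interval(3,4)[OF \<D>(1)] in blast)
    also have "\<dots> = F * (\<Sum>K\<in>\<D>. norm (g (Sup K) - g (Inf K))) + G * (\<Sum>K\<in>\<D>. norm (f (Sup K) - f (Inf K)))"
      by (simp add: sum.distrib sum_distrib_left)
    also have "\<dots> < F * (\<epsilon> / (2 * F)) + G * (\<epsilon> / (2 * G))"
      using \<D> \<open>0 < F\<close> \<open>0 < G\<close> by (intro add_strict_mono mult_strict_left_mono \<delta>\<^sub>f \<delta>\<^sub>g) auto
    also have "\<dots> = \<epsilon>"
      using \<open>0 < F\<close> \<open>0 < G\<close> by simp
    finally show "(\<Sum>K\<in>\<D>. norm (f (Sup K) * g (Sup K) - f (Inf K) * g (Inf K))) < \<epsilon>" .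
  qed (use \<open>0 < \<delta>\<^sub>f\<close> \<open>0 < \<delta>\<^sub>g\<close> in auto)
qed

section \<open>Monotonicity and a comparison principle from derivatives almost everywhere\<close>

lemma negligible_open_cover:
  assumes "negligible N" "0 < (\<delta>::real)"
  obtains U where "open U" "N \<subseteq> U" "U \<in> lmeasurable" "measure lebesgue U < \<delta>"
proof -
  have N: "N \<in> lmeasurable" "measure lebesgue N = 0"
    using assms(1) negligible_imp_measurable negligible_iff_measure by blast+
  obtain U where U: "open U" "N \<subseteq> U" "U - N \<in> lmeasurable" "emeasure lebesgue (U - N) < ennreal \<delta>"
    using sets_lebesgue_outer_open[OF fmeasurableD[OF N(1)] \<open>0 < \<delta>\<close>] .
  have eq: "U = (U - N) \<union> N"
    using U(2) by blast
  have "U \<in> lmeasurable"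
    by (subst eq) (intro fmeasurable.Un U N)
  moreover have "measure lebesgue U \<le> measure lebesgue (U - N) + measure lebesgue N"
    by (subst eq) (intro measure_Un_le fmeasurableD U N)
  moreover have "measure lebesgue (U - N) < \<delta>"
    using U(3,4) \<open>0 < \<delta>\<close> by (simp add: emeasure_eq_measure2 ennreal_less_iff)
  ultimately show ?thesis
    using that U(1,2) N(2) by simp
qed

(* In a tagged division that is fine enough, the intervals tagged in the exceptional set N lie in an
   open set of small measure and are controlled by absolute continuity; the other intervals are
   controlled by the derivative at their tags. *)
lemma abs_continuous_on_deriv_nonneg_imp_le:
  fixes f :: "real \<Rightarrow> real"
  assumes f: "abs_continuous_on a b f" and "a \<le> b" and N: "negligible N"
    and deriv: "\<And>t. t \<in> {a..b} - N \<Longrightarrow> \<exists>d\<ge>0. (f has_real_derivative d) (at t within {a..b})"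
  shows "f a \<le> f b"
proof (rule field_le_epsilon)
  fix \<epsilon>' :: real assume "0 < \<epsilon>'"
  \<comment> \<open>Intervals with regular tags will cost at most \<epsilon> (b - a), those tagged
    in \<open>N\<close> at most \<epsilon>; the total is \<epsilon>'.\<close>
  define \<epsilon> where "\<epsilon> = \<epsilon>' / (b - a + 1)"
  have "0 < \<epsilon>"
    using \<open>0 < \<epsilon>'\<close> \<open>a \<le> b\<close> by (simp add: \<epsilon>_def)
  obtain \<delta> where "0 < \<delta>" and \<delta>: "\<And>\<D>. \<D> division_of \<Union>\<D> \<Longrightarrow> \<Union>\<D> \<subseteq> {a..b} \<Longrightarrow>
      (\<Sum>K\<in>\<D>. Sup K - Inf K) < \<delta> \<Longrightarrow> (\<Sum>K\<in>\<D>. norm (f (Sup K) - f (Inf K))) < \<epsilon>"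
    using abs_continuous_onE[OF f \<open>0 < \<epsilon>\<close>] by blast
  obtain U where U: "open U" "N \<subseteq> U" "U \<in> lmeasurable" "measure lebesgue U < \<delta>"
    using negligible_open_cover[OF N \<open>0 < \<delta>\<close>] .
  \<comment> \<open>The factor s - t lets one inequality cover both sides of the tag.\<close>
  have "\<exists>r>0. \<forall>s\<in>{a..b}. \<bar>s - t\<bar> < r \<longrightarrow> (s - t) * (f s - f t) \<ge> - \<epsilon> * (s - t)\<^sup>2"
    if t: "t \<in> {a..b} - N" for t
  proof -
    obtain d where "0 \<le> d" and d: "(f has_real_derivative d) (at t within {a..b})"
      using deriv[OF t] by blast
    obtain r where "0 < r" and r: "\<And>s. s \<in> {a..b} \<Longrightarrow> \<bar>s - t\<bar> < r \<Longrightarrow>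
        \<bar>f s - f t - d * (s - t)\<bar> \<le> \<epsilon> * \<bar>s - t\<bar>"
      using d \<open>0 < \<epsilon>\<close> unfolding has_field_derivative_def has_derivative_within_alt real_norm_def by blast
    have "(s - t) * (f s - f t) \<ge> - \<epsilon> * (s - t)\<^sup>2" if "s \<in> {a..b}" "\<bar>s - t\<bar> < r" for s
    proof -
      have "\<bar>s - t\<bar> * \<bar>f s - f t - d * (s - t)\<bar> \<le> \<bar>s - t\<bar> * (\<epsilon> * \<bar>s - t\<bar>)"
        using r[OF that] by (intro mult_left_mono) auto
      then have "\<bar>(s - t) * (f s - f t - d * (s - t))\<bar> \<le> \<epsilon> * (s - t)\<^sup>2"
        by (simp add: abs_mult power2_eq_square ac_simps abs_mult_self_eq)
      moreover have "(s - t) * (f s - f t - d * (s - t)) = (s - t) * (f s - f t) - d * (s - t)\<^sup>2"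
        by (simp add: algebra_simps power2_eq_square)
      moreover have "0 \<le> d * (s - t)\<^sup>2"
        using \<open>0 \<le> d\<close> by simp
      ultimately show ?thesis by linarith
    qed
    with \<open>0 < r\<close> show ?thesis by blast
  qed
  then obtain r where r0: "\<And>t. t \<in> {a..b} - N \<Longrightarrow> 0 < r t"
    and r: "\<And>t s. t \<in> {a..b} - N \<Longrightarrow> s \<in> {a..b} \<Longrightarrow> \<bar>s - t\<bar> < r t \<Longrightarrow> (s - t) * (f s - f t) \<ge> - \<epsilon> * (s - t)\<^sup>2"
    by metis
  define g where "g t = (if t \<in> N then U else if t \<in> {a..b} then ball t (r t) else UNIV)" for t
  have "gauge g"
    using U(1,2) r0 by (auto simp: gauge_def g_def)
  then obtain P where P: "P tagged_division_of {a..b}" "g fine P"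
    using fine_division_exists_real by blast
  have K: "K = {Inf K..Sup K}" "Inf K \<le> t" "t \<le> Sup K" "{Inf K..Sup K} \<subseteq> {a..b}" "K \<subseteq> g t"
    if tK: "(t, K) \<in> P" for t K
  proof -
    obtain u v where "K = cbox u v"
      using tagged_division_ofD(4)[OF P(1) tK] by blast
    moreover have "t \<in> K"
      using tagged_division_ofD(2)[OF P(1) tK] .
    ultimately have uv: "K = {u..v}" "u \<le> t" "t \<le> v"
      by auto
    then show "K = {Inf K..Sup K}" "Inf K \<le> t" "t \<le> Sup K" "{Inf K..Sup K} \<subseteq> {a..b}"
      using tagged_division_ofD(3)[OF P(1) tK] by auto
    show "K \<subseteq> g t"
      using P(2) tK by (auto simp: fine_def)
  qed
  have "finite P"
    using P(1) by blast
  define Q where "Q = {(t, K) \<in> P. t \<in> N}"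
  have "Q \<subseteq> P"
    by (auto simp: Q_def)
  have Q: "Q tagged_division_of \<Union>(snd ` Q)"
    using P(1) \<open>Q \<subseteq> P\<close> by (meson tagged_division_of_def tagged_partial_division_of_Union_self
        tagged_partial_division_subset)
  have div: "snd ` Q division_of \<Union>(snd ` Q)"
    using Q by (rule division_of_tagged_division)
  have "L \<subseteq> {a..b} \<and> L \<subseteq> U" if "(t, L) \<in> Q" for t L
    using tagged_division_ofD(3)[OF P(1), of t L] K(5)[of t L] that by (simp add: Q_def g_def)
  then have "\<Union>(snd ` Q) \<subseteq> {a..b}" "\<Union>(snd ` Q) \<subseteq> U"
    by fastforce+
  have "(\<Sum>L\<in>snd ` Q. Sup L - Inf L) = (\<Sum>L\<in>snd ` Q. measure lebesgue L)"
  proof (rule sum.cong)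
    fix L assume "L \<in> snd ` Q"
    note L = division_real_interval[OF div this]
    have "measure lebesgue {Inf L..Sup L} = Sup L - Inf L"
      using L(2) by (simp add: measure_completion)
    then show "Sup L - Inf L = measure lebesgue L"
      using L(1) by simp
  qed simp
  also have "\<dots> = measure lebesgue (\<Union>(snd ` Q))"
    using div by (rule content_division)
  also have "\<dots> \<le> measure lebesgue U"
    using \<open>\<Union>(snd ` Q) \<subseteq> U\<close> lmeasurable_division[OF div] U(3)
    by (intro measure_mono_fmeasurable) auto
  finally have "(\<Sum>L\<in>snd ` Q. norm (f (Sup L) - f (Inf L))) < \<epsilon>"
    using U(4) \<open>\<Union>(snd ` Q) \<subseteq> {a..b}\<close> div by (intro \<delta>) auto
  \<comment> \<open>Absolute continuity speaks of sets of intervals, the division of tagged ones. An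
    interval with two different tags has empty interior, so it is a point and its increment is
    0.\<close>
  moreover have "(\<Sum>(t, L)\<in>Q. norm (f (Sup L) - f (Inf L))) = (\<Sum>L\<in>snd ` Q. norm (f (Sup L) - f (Inf L)))"
  proof -
    have "f (Sup L) = f (Inf L)" if "(t, L) \<in> Q" "(t', L) \<in> Q" "t \<noteq> t'" for t t' L
    proof -
      have "interior L = {}"
        using tagged_division_ofD(5)[OF Q that(1,2)] that(3) by simp
      moreover have "L = {Inf L..Sup L}" "Inf L \<le> Sup L"
        using division_real_interval(1,2)[OF div, of L] that(1) by force+
      ultimately have "\<not> Inf L < Sup L"
        by (metis greaterThanLessThan_empty_iff interior_atLeastAtMost_real not_le)
      with \<open>Inf L \<le> Sup L\<close> show ?thesis
        by simp
    qed
    then show ?thesis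
      unfolding case_prod_unfold using \<open>finite P\<close> \<open>Q \<subseteq> P\<close>
      by (subst sum.reindex_nontrivial) (auto dest: finite_subset, blast)
  qed
  ultimately have Q_sum: "(\<Sum>(t, L)\<in>Q. norm (f (Sup L) - f (Inf L))) < \<epsilon>"
    by simp
  have inc: "f (Sup L) - f (Inf L) \<ge> - \<epsilon> * (Sup L - Inf L)" if tL: "(t, L) \<in> P - Q" for t L
  proof -
    have "t \<notin> N" and tL': "(t, L) \<in> P"
      using tL by (auto simp: Q_def)
    note KL = K[OF tL']
    have mem: "Inf L \<in> L" "Sup L \<in> L"
      by (metis KL(1-3) atLeastAtMost_iff order_refl order_trans)+
    have ab: "Inf L \<in> {a..b}" "Sup L \<in> {a..b}"
      using KL(2-4) by auto
    have t: "t \<in> {a..b} - N"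
      using KL(2-4) \<open>t \<notin> N\<close> by auto
    then have "L \<subseteq> ball t (r t)"
      using KL(5) by (simp add: g_def)
    then have ball: "\<bar>Inf L - t\<bar> < r t" "\<bar>Sup L - t\<bar> < r t"
      using mem by (auto simp: dist_real_def abs_minus_commute dest: subsetD)
    have up: "f (Sup L) - f t \<ge> - \<epsilon> * (Sup L - t)"
    proof (cases "Sup L = t")
      case False
      then have "0 < Sup L - t"
        using KL(3) by simp
      moreover have "(Sup L - t) * (f (Sup L) - f t) \<ge> (Sup L - t) * (- \<epsilon> * (Sup L - t))"
        using r[OF t ab(2) ball(2)] by (simp add: power2_eq_square ac_simps)
      ultimately show ?thesis
        by (metis mult_le_cancel_left_pos)
    qed simp
    have lo: "f t - f (Inf L) \<ge> - \<epsilon> * (t - Inf L)"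
    proof (cases "Inf L = t")
      case False
      then have "0 < t - Inf L"
        using KL(2) by simp
      moreover have "(t - Inf L) * (f t - f (Inf L)) \<ge> (t - Inf L) * (- \<epsilon> * (t - Inf L))"
        using r[OF t ab(1) ball(1)] by (simp add: power2_eq_square algebra_simps)
      ultimately show ?thesis
        by (metis mult_le_cancel_left_pos)
    qed simp
    from up lo show ?thesis
      by (simp add: algebra_simps)
  qed
  have lenP: "(\<Sum>(t, L)\<in>P. Sup L - Inf L) = b - a"
    using additive_tagged_division_1[OF \<open>a \<le> b\<close> P(1), of "\<lambda>t. t"] by simp
  have "(\<Sum>(t, L)\<in>P - Q. Sup L - Inf L) \<le> (\<Sum>(t, L)\<in>P. Sup L - Inf L)"
    using \<open>finite P\<close> K(2,3) by (intro sum_mono2) (auto simp: Q_def split: prod.splits, force)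
  then have "\<epsilon> * (\<Sum>(t, L)\<in>P - Q. Sup L - Inf L) \<le> \<epsilon> * (b - a)"
    using \<open>0 < \<epsilon>\<close> lenP by (intro mult_left_mono) auto
  moreover have "(\<Sum>(t, L)\<in>P - Q. - \<epsilon> * (Sup L - Inf L)) \<le> (\<Sum>(t, L)\<in>P - Q. f (Sup L) - f (Inf L))"
    using inc by (intro sum_mono) auto
  moreover have "(\<Sum>(t, L)\<in>P - Q. - \<epsilon> * (Sup L - Inf L)) = - \<epsilon> * (\<Sum>(t, L)\<in>P - Q. Sup L - Inf L)"
    by (simp add: sum_distrib_left case_prod_unfold)
  moreover have "- (\<Sum>(t, L)\<in>Q. norm (f (Sup L) - f (Inf L))) \<le> (\<Sum>(t, L)\<in>Q. f (Sup L) - f (Inf L))"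
    unfolding sum_negf[symmetric] by (intro sum_mono) auto
  moreover have "f b - f a = (\<Sum>(t, L)\<in>P - Q. f (Sup L) - f (Inf L)) + (\<Sum>(t, L)\<in>Q. f (Sup L) - f (Inf L))"
    using additive_tagged_division_1[OF \<open>a \<le> b\<close> P(1), of f] sum.subset_diff[OF \<open>Q \<subseteq> P\<close> \<open>finite P\<close>]
    by metis
  ultimately have "f b - f a \<ge> - \<epsilon> * (b - a) - \<epsilon>"
    using Q_sum by linarith
  also have "- \<epsilon> * (b - a) - \<epsilon> = - (\<epsilon> * (b - a + 1))"
    by (simp add: algebra_simps)
  also have "\<epsilon> * (b - a + 1) = \<epsilon>'"
    using \<open>a \<le> b\<close> by (simp add: \<epsilon>_def)
  finally show "f a \<le> f b + \<epsilon>'" by simp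
qed

text \<open>\<open>c\<close> is the equilibrium of z' = \<alpha> (c - z). The integrating factor exp
  (\<alpha> (t - a)) turns z - c into a function with nonnegative derivative outside
  \<open>N\<close>.\<close>

lemma linear_differential_inequality:
  fixes z :: "real \<Rightarrow> real"
  assumes z: "abs_continuous_on a b z" and "a \<le> b" and "0 < \<alpha>" and N: "negligible N"
    and deriv: "\<And>t. t \<in> {a..b} - N \<Longrightarrow>
      \<exists>d\<ge>\<alpha> * (c - z t). (z has_real_derivative d) (at t within {a..b})"
  shows "c + (z a - c) * exp (- \<alpha> * (b - a)) \<le> z b"
proof -
  let ?E = "\<lambda>t. exp (\<alpha> * (t - a))"
  have "bounded ((\<lambda>t. \<alpha> * ?E t) ` {a..b})"
    by (intro compact_imp_bounded compact_continuous_image continuous_intros) auto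
  then obtain L where "0 < L" and L: "\<And>t. t \<in> {a..b} \<Longrightarrow> \<bar>\<alpha> * ?E t\<bar> \<le> L"
    by (auto simp: bounded_pos)
  have "L-lipschitz_on {a..b} ?E"
  proof (rule bounded_derivative_imp_lipschitz)
    fix t assume "t \<in> {a..b}"
    show "(?E has_derivative (\<lambda>h. (\<alpha> * ?E t) * h)) (at t within {a..b})"
      by (auto intro!: derivative_eq_intros)
    show "onorm (\<lambda>h. (\<alpha> * ?E t) * h) \<le> L"
      using L[OF \<open>t \<in> {a..b}\<close>] by (intro onorm_le) (simp add: abs_mult mult_right_mono)
  qed (use \<open>0 < L\<close> in auto)
  then have E: "abs_continuous_on a b ?E"
    by (rule lipschitz_on_imp_abs_continuous_on)
  have "abs_continuous_on a b (\<lambda>t. z t - c)"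
    using z by (rule abs_continuous_on_norm_le) simp
  with E have "abs_continuous_on a b (\<lambda>t. ?E t * (z t - c))"
    by (rule abs_continuous_on_mult)
  then have "?E a * (z a - c) \<le> ?E b * (z b - c)"
    using \<open>a \<le> b\<close> N
  proof (rule abs_continuous_on_deriv_nonneg_imp_le)
    fix t assume "t \<in> {a..b} - N"
    then obtain d where d: "\<alpha> * (c - z t) \<le> d" "(z has_real_derivative d) (at t within {a..b})"
      using deriv by blast
    have "((\<lambda>t. ?E t * (z t - c)) has_real_derivative ?E t * (d - \<alpha> * (c - z t))) (at t within {a..b})"
      by (rule derivative_eq_intros d(2) refl)+ (simp add: algebra_simps)
    moreover have "0 \<le> ?E t * (d - \<alpha> * (c - z t))"
      using d(1) by simp
    ultimately show "\<exists>d\<ge>0. ((\<lambda>t. ?E t * (z t - c)) has_real_derivative d) (at t within {a..b})"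
      by blast
  qed
  then have "exp (- \<alpha> * (b - a)) * (z a - c) \<le> exp (- \<alpha> * (b - a)) * (?E b * (z b - c))"
    by (intro mult_left_mono) auto
  also have "\<dots> = z b - c"
    by (simp flip: mult.assoc exp_add)
  finally show ?thesis
    by (simp add: algebra_simps)
qed

subsection \<open>Solutions dominated by a strict supersolution\<close>

lemma ex_scaling_ge:
  fixes p :: "'i::finite \<Rightarrow> real"
  assumes "\<And>i. 0 < p i"
  shows "\<exists>K>0. \<forall>i. X \<le> K * p i"
proof -
  define m where "m = Min (range p)"
  have "0 < m"
    using assms by (simp add: m_def)
  have m: "m \<le> p i" for i
    by (simp add: m_def)
  have "X \<le> (\<bar>X\<bar> + 1) / m * p i" for i
  proof -
    have "X \<le> (\<bar>X\<bar> + 1) / m * m"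
      using \<open>0 < m\<close> by simp
    also have "\<dots> \<le> (\<bar>X\<bar> + 1) / m * p i"
      using \<open>0 < m\<close> m by (intro mult_left_mono) auto
    finally show ?thesis .
  qed
  moreover have "0 < (\<bar>X\<bar> + 1) / m"
    using \<open>0 < m\<close> by simp
  ultimately show ?thesis by blast
qed

text \<open>Turns finitely many strict inequalities into one rate relative to \<open>p\<close>:
  scale -f above the largest absolute value of an entry of \<open>p\<close> and take the reciprocal
  of the factor.\<close>

lemma ex_uniform_margin:
  fixes f p :: "'i::finite \<Rightarrow> real"
  assumes "\<And>i. f i < 0"
  shows "\<exists>\<delta>>0. \<forall>i. f i \<le> - \<delta> * p i"
proof -
  obtain K where "0 < K" and K: "\<And>i. Max (range (\<lambda>i. \<bar>p i\<bar>)) \<le> K * - f i"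
    using ex_scaling_ge[of "\<lambda>i. - f i"] assms neg_0_less_iff_less by blast
  have "f i \<le> - (1 / K) * p i" for i
  proof -
    have "p i \<le> \<bar>p i\<bar>" by simp
    also have "\<dots> \<le> Max (range (\<lambda>i. \<bar>p i\<bar>))"
      by (intro Max_ge) auto
    also have "\<dots> \<le> K * - f i"
      by (rule K)
    finally have "1 / K * p i \<le> 1 / K * (K * - f i)"
      using \<open>0 < K\<close> by (intro mult_left_mono) auto
    then show ?thesis
      using \<open>0 < K\<close> by simp
  qed
  then show ?thesis
    using \<open>0 < K\<close> by (intro exI[of _ "1 / K"]) auto
qed

text \<open>Collects one solution together with constants tied only to the matrices and to
  \<open>p\<close>, \<open>q\<close>. The theorem fixes these constants before the solution is
  given, which makes them uniform.\<close>

locale solution_with_supersolution =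
  fixes A :: "real^'n^'n" and B :: "real^'m^'n" and C :: "real^'n^'m" and D :: "real^'m^'m"
    and hM :: real and h\<^sub>1 h\<^sub>2 :: "real \<Rightarrow> real" and \<psi> :: "real^'n" and \<phi> :: "real \<Rightarrow> real^'m"
    and x :: "real \<Rightarrow> real^'n" and y :: "real \<Rightarrow> real^'m"
    and p :: "real^'n" and q :: "real^'m" and \<alpha> \<delta> \<mu> :: real
  assumes A: "metzler A" and B: "0 \<le> B" and C: "0 \<le> C" and D: "0 \<le> D"
    and h\<^sub>1: "delay hM h\<^sub>1" and h\<^sub>2: "delay hM h\<^sub>2"
    and sol: "is_solution A B C D hM h\<^sub>1 h\<^sub>2 \<psi> \<phi> x y"
    and p: "\<And>i. 0 < p $ i" and q: "\<And>j. 0 < q $ j"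
    and \<alpha>: "0 < \<alpha>" "\<And>i. - \<alpha> \<le> A $ i $ i"
    and \<delta>: "0 < \<delta>" "\<And>i. (A *v p + B *v q) $ i \<le> - \<delta> * p $ i"
    and \<mu>: "0 < \<mu>" "\<mu> < 1" "\<And>j. (C *v p + D *v q) $ j \<le> (1 - \<mu>) * q $ j" "\<mu> \<le> \<delta> / (2 * \<alpha>)"
begin

lemma delay_bounds:
  assumes "0 \<le> t"
  shows "0 \<le> h\<^sub>1 t" "h\<^sub>1 t \<le> hM" "0 \<le> h\<^sub>2 t" "h\<^sub>2 t \<le> hM"
  using h\<^sub>1 h\<^sub>2 assms by (auto simp: delay_def)

text \<open>Two nonnegative gains are subtracted: the approach to the equilibrium c \<delta> p_i /
  \<alpha>, and what is left of the slack at time \<open>a\<close>. \<open>bound_decreases\<close>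
  exploits the former, \<open>bound_contracts\<close> the latter.\<close>

lemma x_component_bound:
  assumes "0 \<le> a" "a \<le> t" "0 \<le> c"
    and x_le: "\<And>s. a \<le> s \<Longrightarrow> s \<le> t \<Longrightarrow> x s \<le> c *\<^sub>R p"
    and y_le: "\<And>s. a - hM \<le> s \<Longrightarrow> s \<le> t \<Longrightarrow> y s \<le> c *\<^sub>R q"
  shows "x t $ i \<le> c * p $ i - (c * \<delta> / \<alpha> * p $ i * (1 - exp (- \<alpha> * (t - a))) +
    (c * p $ i - x a $ i) * exp (- \<alpha> * (t - a)))"
proof -
  let ?z = "\<lambda>s. c * p $ i - x s $ i"
  obtain N where N: "negligible N" and der: "\<And>s. s \<notin> N \<Longrightarrow> 0 \<le> s \<Longrightarrow>
      (x has_vector_derivative (A *v x s + B *v y (s - h\<^sub>1 s))) (at s within {0..})"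
    using sol unfolding is_solution_def eventually_ae_filter negligible_iff_null_sets by auto
  have "abs_continuous_on a t x"
    using sol assms(1) by (auto simp: is_solution_def locally_abs_continuous_on_def)
  then have "abs_continuous_on a t ?z"
  proof (rule abs_continuous_on_norm_le)
    show "norm (?z v - ?z u) \<le> norm (x v - x u)" for u v
      using component_le_norm_cart[of "x v - x u" i] by simp
  qed
  then have "c * \<delta> / \<alpha> * p $ i + (?z a - c * \<delta> / \<alpha> * p $ i) * exp (- \<alpha> * (t - a)) \<le> ?z t"
    using \<open>a \<le> t\<close> \<alpha>(1) N
  proof (rule linear_differential_inequality)
    fix s assume s: "s \<in> {a..t} - N"
    define w where "w = c *\<^sub>R p - x s"
    define v where "v = c *\<^sub>R q - y (s - h\<^sub>1 s)"
    have "0 \<le> s"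
      using s \<open>0 \<le> a\<close> by simp
    have "0 \<le> w"
      using x_le[of s] s by (simp add: w_def)
    have "0 \<le> v"
      using y_le[of "s - h\<^sub>1 s"] s delay_bounds[OF \<open>0 \<le> s\<close>] by (simp add: v_def)
    then have "0 \<le> B *v v"
      using matrix_vector_mult_mono[OF B, of 0 v] by simp
    then have Bv: "0 \<le> (B *v v) $ i"
      by (simp add: less_eq_vec_def)
    have "- \<alpha> * w $ i \<le> A $ i $ i * w $ i"
      using \<alpha>(2) \<open>0 \<le> w\<close> by (intro mult_right_mono) (auto simp: less_eq_vec_def)
    also have "\<dots> \<le> (A *v w) $ i"
      using A \<open>0 \<le> w\<close> by (rule metzler_mult_component_ge)
    finally have Aw: "- \<alpha> * w $ i \<le> (A *v w) $ i" .
    have "c * (A *v p + B *v q) $ i \<le> c * (- \<delta> * p $ i)"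
      using \<delta>(2) \<open>0 \<le> c\<close> by (rule mult_left_mono)
    moreover have "- (A *v x s + B *v y (s - h\<^sub>1 s)) $ i =
        (A *v w) $ i + (B *v v) $ i - c * (A *v p + B *v q) $ i"
      by (simp add: w_def v_def matrix_vector_mult_diff_distrib matrix_vector_mult_scaleR algebra_simps)
    ultimately have "c * \<delta> * p $ i - \<alpha> * w $ i \<le> - (A *v x s + B *v y (s - h\<^sub>1 s)) $ i"
      using Aw Bv by (simp add: algebra_simps)
    also have "c * \<delta> * p $ i - \<alpha> * w $ i = \<alpha> * (c * \<delta> / \<alpha> * p $ i - ?z s)"
      using \<alpha>(1) by (simp add: w_def field_simps)
    finally have "\<alpha> * (c * \<delta> / \<alpha> * p $ i - ?z s) \<le> - (A *v x s + B *v y (s - h\<^sub>1 s)) $ i" .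
    moreover have "(x has_vector_derivative (A *v x s + B *v y (s - h\<^sub>1 s))) (at s within {a..t})"
      using der[of s] s \<open>0 \<le> a\<close> \<open>0 \<le> s\<close> by (auto elim: has_vector_derivative_within_subset)
    then have "((\<lambda>s. x s $ i) has_real_derivative (A *v x s + B *v y (s - h\<^sub>1 s)) $ i) (at s within {a..t})"
      using bounded_linear.has_vector_derivative[OF bounded_linear_vec_nth]
      unfolding has_real_derivative_iff_has_vector_derivative by blast
    then have "(?z has_real_derivative 0 - (A *v x s + B *v y (s - h\<^sub>1 s)) $ i) (at s within {a..t})"
      by (intro DERIV_diff DERIV_const)
    ultimately show "\<exists>d\<ge>\<alpha> * (c * \<delta> / \<alpha> * p $ i - ?z s). (?z has_real_derivative d) (at s within {a..t})"
      by (metis diff_0)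
  qed
  then show ?thesis
    by (simp add: algebra_simps)
qed

text \<open>The bound on \<open>y\<close> is assumed up to \<open>t\<close> itself because
  \<open>h\<^sub>2 t\<close> may be 0. The lemma thus sharpens a bound already known and cannot
  create one.\<close>

lemma y_le_contracted:
  assumes "0 \<le> a" "a \<le> t" "0 \<le> c"
    and x_le: "x t \<le> c *\<^sub>R p"
    and y_le: "\<And>s. a - hM \<le> s \<Longrightarrow> s \<le> t \<Longrightarrow> y s \<le> c *\<^sub>R q"
  shows "y t \<le> (c * (1 - \<mu>)) *\<^sub>R q"
proof -
  have "0 \<le> t"
    using assms by simp
  have "y t = C *v x t + D *v y (t - h\<^sub>2 t)"
    using sol \<open>0 \<le> t\<close> by (simp add: is_solution_def)
  also have "\<dots> \<le> C *v (c *\<^sub>R p) + D *v (c *\<^sub>R q)"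
    using delay_bounds[OF \<open>0 \<le> t\<close>] assms
    by (intro add_mono matrix_vector_mult_mono C D x_le y_le) auto
  also have "\<dots> = c *\<^sub>R (C *v p + D *v q)"
    by (simp add: matrix_vector_mult_scaleR scaleR_add_right)
  also have "\<dots> \<le> c *\<^sub>R ((1 - \<mu>) *\<^sub>R q)"
    using \<mu>(3) \<open>0 \<le> c\<close> by (intro scaleR_left_mono) (auto simp: less_eq_vec_def)
  finally show ?thesis
    by simp
qed

text \<open>The excess \<open>K\<close> over the level \<open>r\<close> shrinks for both components.
  For \<open>y\<close> the factor is 1 - \<mu>. For \<open>x\<close> the data at time
  \<open>a\<close> leave the slack K p, of which at least the fraction exp (- \<alpha> (b - a))
  survives on the interval.\<close>

lemma bound_contracts:
  fixes a b r K :: real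
  defines "\<theta> \<equiv> max (1 - \<mu>) (1 - exp (- \<alpha> * (b - a)))"
  assumes "0 \<le> a" "0 \<le> r" "0 \<le> K"
    and x_a: "x a \<le> r *\<^sub>R p"
    and y_a: "\<And>s. a - hM \<le> s \<Longrightarrow> s < a \<Longrightarrow> y s \<le> r *\<^sub>R q"
    and bound: "\<And>s. a \<le> s \<Longrightarrow> s \<le> b \<Longrightarrow> x s \<le> (r + K) *\<^sub>R p \<and> y s \<le> (r + K) *\<^sub>R q"
    and t: "a \<le> t" "t \<le> b"
  shows "x t \<le> (r + \<theta> * K) *\<^sub>R p \<and> y t \<le> (r + \<theta> * K) *\<^sub>R q"
proof
  have p0: "0 \<le> p" and q0: "0 \<le> q"
    using p q by (auto simp: less_eq_vec_def less_imp_le)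
  have x_le: "x s \<le> (r + K) *\<^sub>R p" if "a \<le> s" "s \<le> t" for s
    using bound[of s] that t by simp
  have y_le: "y s \<le> (r + K) *\<^sub>R q" if "a - hM \<le> s" "s \<le> t" for s
  proof (cases "a \<le> s")
    case False
    then have "y s \<le> r *\<^sub>R q"
      using y_a[of s] that by simp
    also have "\<dots> \<le> (r + K) *\<^sub>R q"
      using q0 \<open>0 \<le> K\<close> by (intro scaleR_right_mono) auto
    finally show ?thesis .
  qed (use bound[of s] that t in simp)
  have "y t \<le> ((r + K) * (1 - \<mu>)) *\<^sub>R q"
    using \<open>0 \<le> a\<close> t(1) _ x_le[OF t(1) order_refl] y_le
    by (rule y_le_contracted) (use \<open>0 \<le> r\<close> \<open>0 \<le> K\<close> in simp)
  also have "\<dots> \<le> (r + \<theta> * K) *\<^sub>R q"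
  proof (rule scaleR_right_mono[OF _ q0])
    have "r * (1 - \<mu>) \<le> r" "(1 - \<mu>) * K \<le> \<theta> * K"
      using \<open>0 \<le> r\<close> \<open>0 \<le> K\<close> \<mu>(1) by (auto simp: \<theta>_def intro!: mult_left_le mult_right_mono)
    then show "(r + K) * (1 - \<mu>) \<le> r + \<theta> * K"
      by (simp add: algebra_simps)
  qed
  finally show "y t \<le> (r + \<theta> * K) *\<^sub>R q" .
  show "x t \<le> (r + \<theta> * K) *\<^sub>R p"
    unfolding less_eq_vec_def
  proof
    fix i
    let ?E = "exp (- \<alpha> * (t - a))"
    have "x t $ i \<le> (r + K) * p $ i -
        ((r + K) * \<delta> / \<alpha> * p $ i * (1 - ?E) + ((r + K) * p $ i - x a $ i) * ?E)"
      by (rule x_component_bound) (use \<open>0 \<le> a\<close> t \<open>0 \<le> r\<close> \<open>0 \<le> K\<close> x_le y_le in auto)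
    moreover have "0 \<le> (r + K) * \<delta> / \<alpha> * p $ i * (1 - ?E)"
      using \<open>0 \<le> r\<close> \<open>0 \<le> K\<close> \<delta>(1) \<alpha>(1) p[of i] t(1)
      by (intro mult_nonneg_nonneg divide_nonneg_pos) (auto simp: less_imp_le)
    moreover have "K * p $ i * ?E \<le> ((r + K) * p $ i - x a $ i) * ?E"
      using x_a by (intro mult_right_mono) (auto simp: less_eq_vec_def algebra_simps)
    moreover have "K * p $ i * (1 - \<theta>) \<le> K * p $ i * ?E"
    proof (rule mult_left_mono)
      have "1 - \<theta> \<le> exp (- \<alpha> * (b - a))"
        by (simp add: \<theta>_def)
      also have "\<dots> \<le> ?E"
        using \<alpha>(1) t(2) by simp
      finally show "1 - \<theta> \<le> ?E" .
    qed (use \<open>0 \<le> K\<close> p[of i] in \<open>simp add: less_imp_le\<close>)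
    ultimately have "x t $ i \<le> (r + K) * p $ i - K * p $ i * (1 - \<theta>)"
      by linarith
    then show "x t $ i \<le> ((r + \<theta> * K) *\<^sub>R p) $ i"
      by (simp add: algebra_simps)
  qed
qed

text \<open>Start of the iteration. \<open>K\<close> may depend on the solution and on the interval,
  since it disappears in the limit.\<close>

lemma crude_bound:
  assumes "0 \<le> a" "0 \<le> hM"
  shows "\<exists>K>0. \<forall>s\<in>{a..b}. x s \<le> K *\<^sub>R p \<and> y s \<le> K *\<^sub>R q"
proof -
  have "abs_continuous_on a b x"
    using sol \<open>0 \<le> a\<close> by (auto simp: is_solution_def locally_abs_continuous_on_def)
  then have "bounded (x ` {a..b})"
    by (intro compact_imp_bounded compact_continuous_image abs_continuous_on_imp_continuous_on) auto
  then obtain X where X: "\<And>s. s \<in> {a..b} \<Longrightarrow> norm (x s) \<le> X"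
    unfolding bounded_iff by blast
  have "locally_bounded_on {- hM..} y"
    using sol by (simp add: is_solution_def)
  then have "bounded (y ` {a..b})"
    using assms by (auto simp: locally_bounded_on_def)
  then obtain Y where Y: "\<And>s. s \<in> {a..b} \<Longrightarrow> norm (y s) \<le> Y"
    unfolding bounded_iff by blast
  obtain K\<^sub>x where "0 < K\<^sub>x" and K\<^sub>x: "\<And>i. X \<le> K\<^sub>x * p $ i"
    using ex_scaling_ge[of "\<lambda>i. p $ i"] p by blast
  obtain K\<^sub>y where "0 < K\<^sub>y" and K\<^sub>y: "\<And>j. Y \<le> K\<^sub>y * q $ j"
    using ex_scaling_ge[of "\<lambda>j. q $ j"] q by blast
  have "x s $ i \<le> (K\<^sub>x + K\<^sub>y) * p $ i" "y s $ j \<le> (K\<^sub>x + K\<^sub>y) * q $ j" if "s \<in> {a..b}" for s i j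
  proof -
    have "x s $ i \<le> X" "y s $ j \<le> Y"
      using X[OF that] Y[OF that] component_le_norm_cart[of "x s" i] component_le_norm_cart[of "y s" j]
      by linarith+
    moreover have "0 \<le> K\<^sub>y * p $ i" "0 \<le> K\<^sub>x * q $ j"
      using \<open>0 < K\<^sub>x\<close> \<open>0 < K\<^sub>y\<close> p[of i] q[of j] by simp_all
    ultimately show "x s $ i \<le> (K\<^sub>x + K\<^sub>y) * p $ i" "y s $ j \<le> (K\<^sub>x + K\<^sub>y) * q $ j"
      using K\<^sub>x[of i] K\<^sub>y[of j] by (simp_all add: distrib_right)
  qed
  then show ?thesis
    using \<open>0 < K\<^sub>x\<close> \<open>0 < K\<^sub>y\<close> by (intro exI[of _ "K\<^sub>x + K\<^sub>y"]) (auto simp: less_eq_vec_def)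
qed

lemma bound_propagates:
  assumes "0 \<le> a" "0 \<le> hM" "0 \<le> r" "a \<le> t"
    and x_a: "x a \<le> r *\<^sub>R p"
    and y_a: "\<And>s. a - hM \<le> s \<Longrightarrow> s < a \<Longrightarrow> y s \<le> r *\<^sub>R q"
  shows "x t \<le> r *\<^sub>R p" "y t \<le> r *\<^sub>R q"
proof -
  \<comment> \<open>\<theta> may approach 1 for large \<open>t\<close>; this is harmless because the
    limit of its powers is taken with \<open>t\<close> fixed.\<close>
  define \<theta> where "\<theta> = max (1 - \<mu>) (1 - exp (- \<alpha> * (t - a)))"
  have "0 \<le> \<theta>" "\<theta> < 1"
    using \<mu>(1,2) by (auto simp: \<theta>_def)
  obtain K where "0 < K" and K: "\<And>s. s \<in> {a..t} \<Longrightarrow> x s \<le> K *\<^sub>R p \<and> y s \<le> K *\<^sub>R q"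
    using crude_bound[OF assms(1,2)] by blast
  have p0: "0 \<le> p" and q0: "0 \<le> q"
    using p q by (auto simp: less_eq_vec_def less_imp_le)
  \<comment> \<open>Each step needs the previous bound on the whole interval, hence the induction
    with \<open>s\<close> arbitrary.\<close>
  have bound: "x s \<le> (r + \<theta> ^ n * K) *\<^sub>R p \<and> y s \<le> (r + \<theta> ^ n * K) *\<^sub>R q" if "a \<le> s" "s \<le> t" for s n
    using that
  proof (induction n arbitrary: s)
    case 0
    have "K *\<^sub>R p \<le> (r + K) *\<^sub>R p" "K *\<^sub>R q \<le> (r + K) *\<^sub>R q"
      using p0 q0 \<open>0 \<le> r\<close> by (auto intro!: scaleR_right_mono)
    then show ?case
      using K[of s] 0 by (auto intro: order_trans)
  next
    case (Suc n)
    have "0 \<le> \<theta> ^ n * K"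
      using \<open>0 \<le> \<theta>\<close> \<open>0 < K\<close> by simp
    from bound_contracts[OF \<open>0 \<le> a\<close> \<open>0 \<le> r\<close> this x_a y_a Suc.IH Suc.prems] show ?case
      by (simp add: \<theta>_def mult.assoc)
  qed
  have "(\<lambda>n. (r + \<theta> ^ n * K) * v) \<longlonglongrightarrow> (r + 0 * K) * v" for v
    using \<open>0 \<le> \<theta>\<close> \<open>\<theta> < 1\<close> by (intro tendsto_intros LIMSEQ_power_zero) simp
  then have lim: "(\<lambda>n. (r + \<theta> ^ n * K) * v) \<longlonglongrightarrow> r * v" for v
    by simp
  show "x t \<le> r *\<^sub>R p"
    using bound[OF \<open>a \<le> t\<close> order_refl] by (auto simp: less_eq_vec_def intro!: LIMSEQ_le_const[OF lim])
  show "y t \<le> r *\<^sub>R q"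
    using bound[OF \<open>a \<le> t\<close> order_refl] by (auto simp: less_eq_vec_def intro!: LIMSEQ_le_const[OF lim])
qed

text \<open>After time \<open>T\<close> at least half of the equilibrium gain r \<delta> p_i /
  \<alpha> has been realized, and \<mu> <= \<delta> / (2 \<alpha>).\<close>

lemma bound_decreases:
  assumes "0 \<le> a" "0 \<le> hM" "0 \<le> r" "a + T \<le> t" "0 \<le> T" "exp (- \<alpha> * T) \<le> 1 / 2"
    and x_a: "x a \<le> r *\<^sub>R p"
    and y_a: "\<And>s. a - hM \<le> s \<Longrightarrow> s < a \<Longrightarrow> y s \<le> r *\<^sub>R q"
  shows "x t \<le> (r * (1 - \<mu>)) *\<^sub>R p"
  unfolding less_eq_vec_def
proof
  fix i
  note bound = bound_propagates[OF assms(1-3) _ x_a y_a]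
  let ?E = "exp (- \<alpha> * (t - a))"
  have y_le: "y s \<le> r *\<^sub>R q" if "a - hM \<le> s" for s
    using y_a[of s] bound(2)[of s] that by (cases "a \<le> s") auto
  have "x t $ i \<le> r * p $ i - (r * \<delta> / \<alpha> * p $ i * (1 - ?E) + (r * p $ i - x a $ i) * ?E)"
    by (rule x_component_bound) (use assms(1-5) bound(1) y_le in auto)
  moreover have "0 \<le> (r * p $ i - x a $ i) * ?E"
    using x_a by (auto simp: less_eq_vec_def)
  moreover have "r * p $ i * \<mu> \<le> r * p $ i * (\<delta> / \<alpha> * (1 - ?E))"
  proof (rule mult_left_mono)
    have "?E \<le> exp (- \<alpha> * T)"
      using \<open>a + T \<le> t\<close> \<alpha>(1) by simp
    then have "1 / 2 \<le> 1 - ?E"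
      using assms(6) by linarith
    then have "\<delta> / \<alpha> * (1 / 2) \<le> \<delta> / \<alpha> * (1 - ?E)"
      using \<delta>(1) \<alpha>(1) by (intro mult_left_mono) auto
    then show "\<mu> \<le> \<delta> / \<alpha> * (1 - ?E)"
      using \<mu>(4) by simp
  qed (use \<open>0 \<le> r\<close> p[of i] in \<open>simp add: less_imp_le\<close>)
  moreover have "r * \<delta> / \<alpha> * p $ i * (1 - ?E) = r * p $ i * (\<delta> / \<alpha> * (1 - ?E))"
    by simp
  ultimately have "x t $ i \<le> r * p $ i - r * p $ i * \<mu>"
    by linarith
  then show "x t $ i \<le> ((r * (1 - \<mu>)) *\<^sub>R p) $ i"
    by (simp add: algebra_simps)
qed

text \<open>The induction carries the state at time k T: the value of \<open>x\<close> and the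
  history of \<open>y\<close> on the preceding window of length \<open>hM\<close>, both with power
  \<open>k\<close>. Power k + 1 for \<open>y\<close> follows from time k T onwards, and this is what
  the next window requires.\<close>

lemma staircase_bound:
  assumes "0 \<le> hM" "hM \<le> T" "exp (- \<alpha> * T) \<le> 1 / 2"
    and x_0: "x 0 \<le> p" and y_0: "\<And>s. - hM \<le> s \<Longrightarrow> s < 0 \<Longrightarrow> y s \<le> q"
    and t: "real k * T \<le> t"
  shows "x t \<le> (1 - \<mu>) ^ k *\<^sub>R p \<and> y t \<le> (1 - \<mu>) ^ (k + 1) *\<^sub>R q"
proof -
  have "0 \<le> T"
    using assms(1,2) by simp
  then have kT: "0 \<le> real k * T" for k
    by simp
  have r: "0 \<le> (1 - \<mu>) ^ k" for k
    using \<mu>(2) by simp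
  have y_step: "y t \<le> (1 - \<mu>) ^ (k + 1) *\<^sub>R q"
    if "x (real k * T) \<le> (1 - \<mu>) ^ k *\<^sub>R p"
      and y_k: "\<And>s. real k * T - hM \<le> s \<Longrightarrow> s < real k * T \<Longrightarrow> y s \<le> (1 - \<mu>) ^ k *\<^sub>R q"
      and "real k * T \<le> t" for k t
  proof -
    note bound = bound_propagates[OF kT assms(1) r _ that(1) y_k]
    have "y s \<le> (1 - \<mu>) ^ k *\<^sub>R q" if "real k * T - hM \<le> s" for s
      using y_k[of s] bound(2)[of s] that by (cases "real k * T \<le> s") auto
    then have "y t \<le> ((1 - \<mu>) ^ k * (1 - \<mu>)) *\<^sub>R q"
      using bound(1)[OF that(3)] by (intro y_le_contracted[OF kT that(3) r]) auto
    then show ?thesis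
      by (simp add: mult.commute)
  qed
  have "x (real k * T) \<le> (1 - \<mu>) ^ k *\<^sub>R p \<and>
      (\<forall>s. real k * T - hM \<le> s \<longrightarrow> s < real k * T \<longrightarrow> y s \<le> (1 - \<mu>) ^ k *\<^sub>R q)" for k
  proof (induction k)
    case 0
    show ?case
      using x_0 y_0 by simp
  next
    case (Suc k)
    have le: "real k * T + T \<le> real (Suc k) * T"
      by (simp add: algebra_simps)
    have "x (real (Suc k) * T) \<le> ((1 - \<mu>) ^ k * (1 - \<mu>)) *\<^sub>R p"
      using Suc.IH by (intro bound_decreases[OF kT assms(1) r le \<open>0 \<le> T\<close> assms(3)]) auto
    \<comment> \<open>Because hM <= T, the window before (k + 1) T starts no earlier than k T, where
      \<open>y_step\<close> applies.\<close>
    moreover have "y s \<le> (1 - \<mu>) ^ (k + 1) *\<^sub>R q" if "real (Suc k) * T - hM \<le> s" for s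
      using Suc.IH that assms(2) by (intro y_step) (auto simp: algebra_simps)
    ultimately show ?case
      by (simp add: mult.commute)
  qed
  then have IH: "x (real k * T) \<le> (1 - \<mu>) ^ k *\<^sub>R p"
    "\<And>s. real k * T - hM \<le> s \<Longrightarrow> s < real k * T \<Longrightarrow> y s \<le> (1 - \<mu>) ^ k *\<^sub>R q"
    by blast+
  show ?thesis
    using bound_propagates(1)[OF kT assms(1) r t IH] y_step[OF IH t] by blast
qed

end


section \<open>Choice of the constants and conclusion\<close>

theorem theorem2:
  fixes A :: "real^'n^'n" and B :: "real^'m^'n" and C :: "real^'n^'m" and D :: "real^'m^'m"
    and hM :: real and \<psi>\<^sub>b :: "real^'n" and \<phi>\<^sub>b :: "real^'m"
  assumes "metzler A" and "0 \<le> B" and "0 \<le> C" and "0 \<le> D"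
    and "schur D"
    and "spectral_abscissa (A + B ** matrix_inv (mat 1 - D) ** C) < 0"
    and "0 < hM" and "0 \<le> \<psi>\<^sub>b" and "0 \<le> \<phi>\<^sub>b"
  shows "\<exists>(p::real^'n) (q::real^'m) (\<mu>::real) (T::real).
    (\<forall>i. 0 < p $ i) \<and> (\<forall>j. 0 < q $ j) \<and> 0 < \<mu> \<and> \<mu> < 1 \<and> hM \<le> T \<and>
    (\<forall>h\<^sub>1 h\<^sub>2 \<psi> \<phi> x y.
       delay hM h\<^sub>1 \<and> delay hM h\<^sub>2 \<and>
       0 \<le> \<psi> \<and> \<psi> \<le> \<psi>\<^sub>b \<and>
       (\<forall>s\<in>{- hM..<0}. 0 \<le> \<phi> s \<and> \<phi> s \<le> \<phi>\<^sub>b) \<and>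
       is_solution A B C D hM h\<^sub>1 h\<^sub>2 \<psi> \<phi> x y
       \<longrightarrow> (\<forall>k::nat. \<forall>t\<in>{real k * T..<(real k + 1) * T}.
              x t \<le> (1 - \<mu>) ^ k *\<^sub>R p \<and> y t \<le> (1 - \<mu>) ^ (k + 1) *\<^sub>R q))"
proof -
  obtain p\<^sub>0 q\<^sub>0 where p\<^sub>0: "\<And>i. 0 < p\<^sub>0 $ i" and q\<^sub>0: "\<And>j. 0 < q\<^sub>0 $ j"
    and Ap\<^sub>0: "\<And>i. (A *v p\<^sub>0 + B *v q\<^sub>0) $ i < 0"
    and Cp\<^sub>0: "\<And>j. (C *v p\<^sub>0 + D *v q\<^sub>0) $ j < q\<^sub>0 $ j"
    using strict_supersolution_exists[OF assms(1-6)] by blast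
  obtain K\<^sub>p where "0 < K\<^sub>p" and K\<^sub>p: "\<And>i. norm \<psi>\<^sub>b \<le> K\<^sub>p * p\<^sub>0 $ i"
    using ex_scaling_ge[of "\<lambda>i. p\<^sub>0 $ i"] p\<^sub>0 by blast
  obtain K\<^sub>q where "0 < K\<^sub>q" and K\<^sub>q: "\<And>j. norm \<phi>\<^sub>b \<le> K\<^sub>q * q\<^sub>0 $ j"
    using ex_scaling_ge[of "\<lambda>j. q\<^sub>0 $ j"] q\<^sub>0 by blast
  \<comment> \<open>One factor for both vectors: the inequalities for the pair (p, q) are
    homogeneous and preserved by a common scaling, while separate ones could destroy them.\<close>
  define K where "K = max K\<^sub>p K\<^sub>q"
  have "0 < K"
    using \<open>0 < K\<^sub>p\<close> by (simp add: K_def)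
  define p where "p = K *\<^sub>R p\<^sub>0"
  define q where "q = K *\<^sub>R q\<^sub>0"
  have p: "0 < p $ i" for i
    using p\<^sub>0 \<open>0 < K\<close> by (simp add: p_def)
  have q: "0 < q $ j" for j
    using q\<^sub>0 \<open>0 < K\<close> by (simp add: q_def)
  have Ap: "(A *v p + B *v q) $ i < 0" for i
    using Ap\<^sub>0[of i] \<open>0 < K\<close>
    by (simp add: p_def q_def matrix_vector_mult_scaleR mult_pos_neg flip: distrib_left)
  have Cp: "(C *v p + D *v q) $ j - q $ j < 0" for j
    using Cp\<^sub>0[of j] \<open>0 < K\<close>
    by (simp add: p_def q_def matrix_vector_mult_scaleR flip: distrib_left)
  have \<psi>_p: "\<psi>\<^sub>b \<le> p"
    unfolding less_eq_vec_def
  proof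
    fix i
    have "\<psi>\<^sub>b $ i \<le> norm \<psi>\<^sub>b"
      using component_le_norm_cart[of \<psi>\<^sub>b i] by simp
    also have "\<dots> \<le> K\<^sub>p * p\<^sub>0 $ i"
      by (rule K\<^sub>p)
    also have "\<dots> \<le> p $ i"
      using p\<^sub>0[of i] by (simp add: p_def K_def mult_right_mono)
    finally show "\<psi>\<^sub>b $ i \<le> p $ i" .
  qed
  have \<phi>_q: "\<phi>\<^sub>b \<le> q"
    unfolding less_eq_vec_def
  proof
    fix j
    have "\<phi>\<^sub>b $ j \<le> norm \<phi>\<^sub>b"
      using component_le_norm_cart[of \<phi>\<^sub>b j] by simp
    also have "\<dots> \<le> K\<^sub>q * q\<^sub>0 $ j"
      by (rule K\<^sub>q)
    also have "\<dots> \<le> q $ j"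
      using q\<^sub>0[of j] by (simp add: q_def K_def mult_right_mono)
    finally show "\<phi>\<^sub>b $ j \<le> q $ j" .
  qed
  obtain \<delta> where "0 < \<delta>" and \<delta>: "\<And>i. (A *v p + B *v q) $ i \<le> - \<delta> * p $ i"
    using ex_uniform_margin[of "\<lambda>i. (A *v p + B *v q) $ i" "\<lambda>i. p $ i"] Ap by blast
  obtain \<nu> where "0 < \<nu>" and \<nu>: "\<And>j. (C *v p + D *v q) $ j - q $ j \<le> - \<nu> * q $ j"
    using ex_uniform_margin[of "\<lambda>j. (C *v p + D *v q) $ j - q $ j" "\<lambda>j. q $ j"] Cp by blast
  \<comment> \<open>The summand 1 keeps \<alpha> positive even if the diagonal of \<open>A\<close>
    is zero.\<close>
  define \<alpha> where "\<alpha> = (\<Sum>i\<in>UNIV. \<bar>A $ i $ i\<bar>) + 1"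
  have "0 < \<alpha>"
    unfolding \<alpha>_def by (intro add_nonneg_pos sum_nonneg) auto
  have \<alpha>: "- \<alpha> \<le> A $ i $ i" for i
  proof -
    have "\<bar>A $ i $ i\<bar> \<le> (\<Sum>i\<in>UNIV. \<bar>A $ i $ i\<bar>)"
      by (rule member_le_sum) auto
    then show ?thesis
      unfolding \<alpha>_def by linarith
  qed
  \<comment> \<open>The three bounds serve the decrease of \<open>x\<close>, the contraction of
    \<open>y\<close>, and \<mu> < 1.\<close>
  define \<mu> where "\<mu> = min (\<delta> / (2 * \<alpha>)) (min \<nu> (1 / 2))"
  have \<mu>: "0 < \<mu>" "\<mu> < 1" "\<mu> \<le> \<delta> / (2 * \<alpha>)" "\<mu> \<le> \<nu>"
    using \<open>0 < \<delta>\<close> \<open>0 < \<nu>\<close> \<open>0 < \<alpha>\<close> by (auto simp: \<mu>_def)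
  have Cq: "(C *v p + D *v q) $ j \<le> (1 - \<mu>) * q $ j" for j
  proof -
    have "\<mu> * q $ j \<le> \<nu> * q $ j"
      using \<mu>(4) q[of j] by (intro mult_right_mono) auto
    then show ?thesis
      using \<nu>[of j] by (simp add: algebra_simps)
  qed
  define T where "T = max hM (ln 2 / \<alpha>)"
  have "exp (- \<alpha> * T) \<le> exp (- ln 2)"
    using \<open>0 < \<alpha>\<close> by (simp add: T_def mult.commute[of \<alpha>] flip: pos_divide_le_eq)
  then have T: "exp (- \<alpha> * T) \<le> 1 / 2" "hM \<le> T"
    by (auto simp: exp_minus T_def)
  show ?thesis
  proof (rule exI[of _ p], rule exI[of _ q], rule exI[of _ \<mu>], rule exI[of _ T],
      intro conjI allI impI ballI; (elim conjE)?)
    fix h\<^sub>1 h\<^sub>2 \<psi> \<phi> x y and k :: nat and t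
    assume h: "delay hM h\<^sub>1" "delay hM h\<^sub>2" and \<psi>: "\<psi> \<le> \<psi>\<^sub>b"
      and \<phi>: "\<forall>s\<in>{- hM..<0}. 0 \<le> \<phi> s \<and> \<phi> s \<le> \<phi>\<^sub>b"
      and sol: "is_solution A B C D hM h\<^sub>1 h\<^sub>2 \<psi> \<phi> x y"
      and t: "t \<in> {real k * T..<(real k + 1) * T}"
    interpret solution_with_supersolution A B C D hM h\<^sub>1 h\<^sub>2 \<psi> \<phi> x y p q \<alpha> \<delta> \<mu>
      by unfold_locales (fact assms h sol p q \<open>0 < \<alpha>\<close> \<alpha> \<open>0 < \<delta>\<close> \<delta> \<mu> Cq)+
    have "x 0 \<le> p"
      using sol \<psi> \<psi>_p by (auto simp: is_solution_def)
    moreover have "y s \<le> q" if "- hM \<le> s" "s < 0" for s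
      using sol \<phi> \<phi>_q that by (auto simp: is_solution_def intro: order_trans)
    ultimately have "x t \<le> (1 - \<mu>) ^ k *\<^sub>R p \<and> y t \<le> (1 - \<mu>) ^ (k + 1) *\<^sub>R q"
      using \<open>0 < hM\<close> T t by (intro staircase_bound[where T = T]) auto
    then show "x t \<le> (1 - \<mu>) ^ k *\<^sub>R p" "y t \<le> (1 - \<mu>) ^ (k + 1) *\<^sub>R q"
      by blast+
  qed (fact p q \<mu> T)+
qed

end
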